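(* Let $\rho:\mathbb R\to\mathbb R$ be convex and differentiable and assume that $\psi=\rho'$ is $1$-Lipschitz. Consider the Elastic-Net penalty $g(b)=\mu\|b\|^2/2+\lambda\|b\|_1$ with $\mu>0$, $\lambda\ge0$, and let $$\hat\beta=\hat\beta(y,X)=\operatorname{argmin}_{b\in\mathbb R^p}\Big(\frac1n\sum_{i=1}^n\rho(y_i-x_i^\top b)+g(b)\Big).$$ Then for almost every $(y,X)\in\mathbb R^n\times\mathbb R^{n\times p}$, the map $y\mapsto X\hat\beta$ is differentiable at $y$ and $$(\partial/\partial y)X\hat\beta=X_{\hat S}\big(X_{\hat S}^\top\operatorname{diag}(\psi')X_{\hat S}+n\mu I_{|\hat S|}\big)^{-1}X_{\hat S}^\top\operatorname{diag}(\psi'),$$ where $\hat S=\{j\in[p]:\hat\beta_j\ne0\}$ and $X_{\hat S}$ is the submatrix of $X$ made of the columns indexed in $\hat S$, and $$\frac{\partial\hat\psi}{\partial y}=\operatorname{diag}(\psi')^{1/2}\Big[I_n-\operatorname{diag}(\psi')^{1/2}X_{\hat S}\big(X_{\hat S}^\top\operatorname{diag}(\psi')X_{\hat S}+n\mu I_{|\hat S|}\big)^{-1}X_{\hat S}^\top\operatorname{diag}(\psi')^{1/2}\Big]\operatorname{diag}(\psi')^{1/2}.$$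
   Context: $x_1,\dots,x_n$ are the rows of $X\in\mathbb R^{n\times p}$. $\hat\psi=\psi(y-X\hat\beta)\in\mathbb R^n$ with $\psi$ acting componentwise. $\operatorname{diag}(\psi')\in\mathbb R^{n\times n}$ is the diagonal matrix with diagonal entries $\psi'(y_i-x_i^\top\hat\beta)$, $i=1,\dots,n$, where $\psi'$ is the derivative of $\psi$ where it exists. Derivatives with respect to $y$ are taken with $X$ fixed. *)

theory Defs
  imports "HOL-Analysis.Analysis"
begin

definition elastic_net_penalty :: "real \<Rightarrow> real \<Rightarrow> real ^ 'p \<Rightarrow> real" where
  "elastic_net_penalty \<mu> lam b = \<mu> * (norm b)\<^sup>2 / 2 + lam * (\<Sum>j\<in>UNIV. \<bar>b $ j\<bar>)"

definition elastic_net_objective ::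
  "(real \<Rightarrow> real) \<Rightarrow> real \<Rightarrow> real \<Rightarrow> real ^ 'n \<Rightarrow> real ^ 'p ^ 'n \<Rightarrow> real ^ 'p \<Rightarrow> real" where
  "elastic_net_objective \<rho> \<mu> lam y X b =
     (1 / real CARD('n)) * (\<Sum>i\<in>UNIV. \<rho> (y $ i - row i X \<bullet> b)) + elastic_net_penalty \<mu> lam b"

text \<open>For convex \<open>\<rho>\<close> and \<open>\<mu> > 0\<close> the objective is continuous and strongly convex on a
  finite-dimensional space, so it has exactly one minimizer and the choice made by
  \<^const>\<open>arg_min\<close> is immaterial.\<close>

definition elastic_net ::
  "(real \<Rightarrow> real) \<Rightarrow> real \<Rightarrow> real \<Rightarrow> real ^ 'n \<Rightarrow> real ^ 'p ^ 'n \<Rightarrow> real ^ 'p" where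
  "elastic_net \<rho> \<mu> lam y X = (ARG_MIN (elastic_net_objective \<rho> \<mu> lam y X) b. True)"

definition active_set :: "real ^ 'p \<Rightarrow> 'p set" where
  "active_set b = {j. b $ j \<noteq> 0}"

text \<open>The set \<open>S\<close> of active columns depends on \<open>(y, X)\<close>, so a matrix whose rows or columns are
  indexed by \<open>S\<close> cannot have a type of the form \<^typ>\<open>real ^ 's ^ 'r\<close>. A matrix with rows indexed
  by a finite set \<open>I\<close> and columns indexed by a finite set \<open>J\<close> is a function on \<open>I \<times> J\<close>, written
  in curried form; its values outside \<open>I \<times> J\<close> carry no meaning and are never used.\<close>

type_synonym ('a, 'b) set_mat = "'a \<Rightarrow> 'b \<Rightarrow> real"

text \<open>\<open>set_mat_mult J A B\<close> is the product of an \<open>I \<times> J\<close> matrix and a \<open>J \<times> K\<close> matrix.\<close>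

definition set_mat_mult :: "'b set \<Rightarrow> ('a, 'b) set_mat \<Rightarrow> ('b, 'c) set_mat \<Rightarrow> ('a, 'c) set_mat" where
  "set_mat_mult J A B = (\<lambda>i k. \<Sum>j\<in>J. A i j * B j k)"

definition set_mat_add :: "('a, 'b) set_mat \<Rightarrow> ('a, 'b) set_mat \<Rightarrow> ('a, 'b) set_mat" where
  "set_mat_add A B = (\<lambda>i j. A i j + B i j)"

definition set_mat_scale :: "real \<Rightarrow> ('a, 'b) set_mat \<Rightarrow> ('a, 'b) set_mat" where
  "set_mat_scale c A = (\<lambda>i j. c * A i j)"

definition set_mat_transpose :: "('a, 'b) set_mat \<Rightarrow> ('b, 'a) set_mat" where
  "set_mat_transpose A = (\<lambda>j i. A i j)"

definition set_mat_ident :: "('a, 'a) set_mat" where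
  "set_mat_ident = (\<lambda>i j. if i = j then 1 else 0)"

text \<open>The two-sided inverse of a \<open>J \<times> J\<close> matrix. Extensionality fixes the meaningless values
  outside \<open>J \<times> J\<close>, so that the inverse is unique whenever it exists.\<close>

definition set_mat_inverse :: "'a set \<Rightarrow> ('a, 'a) set_mat \<Rightarrow> ('a, 'a) set_mat" where
  "set_mat_inverse J A = (THE B. B \<in> J \<rightarrow>\<^sub>E (J \<rightarrow>\<^sub>E UNIV) \<and>
     (\<forall>i\<in>J. \<forall>k\<in>J. set_mat_mult J A B i k = set_mat_ident i k \<and> set_mat_mult J B A i k = set_mat_ident i k))"

definition entries :: "real ^ 'b ^ 'a \<Rightarrow> ('a, 'b) set_mat" where
  "entries A = (\<lambda>i j. A $ i $ j)"

definition of_entries :: "('a, 'b) set_mat \<Rightarrow> real ^ 'b ^ 'a" where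
  "of_entries A = (\<chi> i j. A i j)"

definition column_submatrix :: "real ^ 'p ^ 'n \<Rightarrow> 'p set \<Rightarrow> ('n, 'p) set_mat" where
  "column_submatrix X S = (\<lambda>i. \<lambda>j\<in>S. X $ i $ j)"

definition diag_matrix :: "real ^ 'n \<Rightarrow> real ^ 'n ^ 'n" where
  "diag_matrix d = (\<chi> i j. if i = j then d $ i else 0)"

text \<open>The \<open>n \<times> n\<close> matrix \<open>X\<^sub>S (X\<^sub>S\<^sup>T D X\<^sub>S + n \<mu> I)\<^sup>-\<^sup>1 X\<^sub>S\<^sup>T\<close>, where the inverse and \<open>I\<close> are
  of size \<open>S \<times> S\<close>.\<close>

definition active_resolvent ::
  "real \<Rightarrow> real ^ 'p ^ 'n \<Rightarrow> 'p set \<Rightarrow> real ^ 'n ^ 'n \<Rightarrow> real ^ 'n ^ 'n" where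
  "active_resolvent \<mu> X S D =
     (let XS = column_submatrix X S;
          G = set_mat_add (set_mat_mult UNIV (set_mat_transpose XS) (set_mat_mult UNIV (entries D) XS))
                   (set_mat_scale (real CARD('n) * \<mu>) set_mat_ident)
      in of_entries (set_mat_mult S XS (set_mat_mult S (set_mat_inverse S G) (set_mat_transpose XS))))"

end

(* For fixed X, the stationarity condition determines beta from the residual r = y - X beta by
   n mu beta_j = S(X_j^T psi(r)), with S the soft threshold at level n lambda.  Hence
   y = r + X beta is a locally Lipschitz function of (r, X), and the exceptional (y, X) form a null
   set as soon as the exceptional (r, X) do.  The latter are the (r, X) for which psi is not
   differentiable at some r_i (a null set, since psi is Lipschitz), or some X_j^T psi(r) lies on
   the kink of S: for psi(r) nonzero this is a hyperplane in X, and for psi(r) = 0 the derivative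
   psi'(r_i) vanishes for almost every r, so that the kink does no harm.  Outside the exceptional
   set the stationarity condition is linearised at y, which is legitimate because beta is a
   Lipschitz function of y. *)

theory Submission
  imports Defs
begin

text \<open>Null sets are known in terms of the residual, but the claim is about (y, X), and a
  Lipschitz map may pull a null set back to a set of positive measure. Images of null sets stay
  null, which is why the residual map is inverted rather than studied directly. Linearising must
  also avoid circularity: the chain rule would presuppose that the residual is differentiable in y.
  If \<psi> is differentiable at f y and f has a Lipschitz bound there, then \<psi> o f minus
  \<psi>'(f y) * f is constant to first order even where f is not differentiable. This yields a
  linear system for \<beta> up to first-order errors, with an invertible matrix frozen at y;
  differentiability of \<beta> is a result of solving it. The case \<psi>(r) = 0 meets the threshold
  only for lam = 0, because all scores are then 0. There S is the identity, and the danger is not a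
  corner of S but a column with \<beta>_j = 0 that the formula leaves out. Differentiability of
  \<psi> almost everywhere comes from monotonicity: \<psi> and t - \<psi> t are both nondecreasing,
  so the Stieltjes measure of \<psi> is dominated by Lebesgue measure.\<close>

section \<open>Differentiability of monotone Lipschitz functions almost everywhere\<close>

text \<open>On an interval the two Stieltjes masses add up to its length, and intervals determine a
  Borel measure. The use is domination: a Lebesgue null set is null for the Stieltjes measure of
  \<open>F\<close>.\<close>

lemma interval_measure_add_complement:
  fixes F :: "real \<Rightarrow> real"
  assumes mono: "mono F" and comono: "mono (\<lambda>x. x - F x)" and cont: "continuous_on UNIV F"
    and A: "A \<in> sets borel"
  shows "emeasure (interval_measure F) A + emeasure (interval_measure (\<lambda>x. x - F x)) A = emeasure lborel A"
proof -
  let ?m1 = "interval_measure F" and ?m2 = "interval_measure (\<lambda>x. x - F x)"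
  define \<nu> where "\<nu> A = emeasure ?m1 A + emeasure ?m2 A" for A
  have ca: "countably_additive (sets borel) \<nu>"
    unfolding countably_additive_def
  proof (intro allI impI)
    fix A :: "nat \<Rightarrow> real set"
    assume A: "range A \<subseteq> sets borel" "disjoint_family A" "\<Union> (range A) \<in> sets borel"
    have "(\<Sum>i. emeasure ?m1 (A i)) = emeasure ?m1 (\<Union> (range A))"
         "(\<Sum>i. emeasure ?m2 (A i)) = emeasure ?m2 (\<Union> (range A))"
      using A by (auto intro!: suminf_emeasure)
    then show "(\<Sum>i. \<nu> (A i)) = \<nu> (\<Union> (range A))"
      unfolding \<nu>_def by (subst suminf_add[symmetric]) auto
  qed
  have pos: "positive (sets borel) \<nu>" by (simp add: positive_def \<nu>_def)
  have sa: "sigma_algebra UNIV (sets (borel :: real measure))"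
    using sets.sigma_algebra_axioms[of borel] by simp
  define M where "M = measure_of UNIV (sets borel) \<nu>"
  have sM: "sets M = sets borel" unfolding M_def
    using sa by (simp add: sigma_algebra.sigma_sets_eq)
  have eM: "emeasure M A = \<nu> A" if "A \<in> sets borel" for A
    unfolding M_def by (rule emeasure_measure_of_sigma[OF sa pos ca that])
  have cr: "continuous (at_right a) F" "continuous (at_right a) (\<lambda>x. x - F x)" for a
    using cont by (auto simp: continuous_on_eq_continuous_within intro!: continuous_intros
      intro: continuous_within_subset)
  have "lborel = M"
  proof (rule lborel_eqI[OF _ sM])
    fix l u :: real assume lu: "\<And>b. b \<in> Basis \<Longrightarrow> l \<bullet> b \<le> u \<bullet> b"
    then have le: "l \<le> u" by simp
    have Icc: "emeasure ?m1 {a..b} = F b - F a" "emeasure ?m2 {a..b} = (b - F b) - (a - F a)"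
      if "a \<le> b" for a b
      using that mono comono cont
      by (auto simp: mono_def intro!: emeasure_interval_measure_Icc continuous_intros)
    have Ioc: "emeasure ?m1 {a<..b} = F b - F a" "emeasure ?m2 {a<..b} = (b - F b) - (a - F a)"
      if "a \<le> b" for a b
      using that mono comono cr
      by (auto simp: mono_def intro!: emeasure_interval_measure_Ioc)
    \<comment> \<open>\<open>lborel_eqI\<close> tests open intervals, while the Stieltjes mass is
      computed on half-open ones; continuity makes the endpoint in between a null set.\<close>
    have z: "emeasure ?m1 {u} = 0" "emeasure ?m2 {u} = 0" using Icc[of u u] by auto
    have nul: "emeasure m ({l<..u} - {u}) = emeasure m {l<..u}" if "emeasure m {u} = 0" "sets m = sets borel" for m
      using that by (intro emeasure_Diff_null_set) (auto simp: null_sets_def)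
    have box: "box l u = {l<..u} - {u}" by (auto simp: box_real)
    have "\<nu> (box l u) = ennreal (F u - F l) + ennreal ((u - F u) - (l - F l))"
      unfolding \<nu>_def box using nul[of ?m1] nul[of ?m2] z Ioc[OF le] by simp
    also have "\<dots> = ennreal (u - l)"
      using monoD[OF mono le] monoD[OF comono le]
      by (subst ennreal_plus[symmetric]) auto
    finally show "emeasure M (box l u) = (\<Prod>b\<in>Basis. (u - l) \<bullet> b)"
      by (subst eM) auto
  qed
  then show ?thesis using eM[OF A] by (simp add: \<nu>_def)
qed

text \<open>\<open>comono\<close> is the upper Lipschitz bound in monotone form. The domination
  above makes the Stieltjes measure of \<open>F\<close> absolutely continuous, and \<open>g\<close>
  is its Radon-Nikodym density.\<close>

lemma mono_Lipschitz_eq_integral: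
  fixes F :: "real \<Rightarrow> real"
  assumes mono: "mono F" and comono: "mono (\<lambda>x. x - F x)" and cont: "continuous_on UNIV F"
  obtains g where "\<And>a b. a \<le> b \<Longrightarrow> (g has_integral (F b - F a)) {a..b}"
proof -
  let ?m = "interval_measure F"
  have "absolutely_continuous lborel ?m"
    unfolding absolutely_continuous_def
  proof
    fix A :: "real set" assume "A \<in> null_sets lborel"
    then show "A \<in> null_sets ?m"
      using interval_measure_add_complement[OF assms, of A] by (auto simp: null_sets_def)
  qed
  then obtain f where f: "f \<in> borel_measurable lborel" "density lborel f = ?m"
    using sigma_finite_measure.Radon_Nikodym[OF sigma_finite_lborel, of ?m] by auto
  have cr: "continuous (at_right a) F" for a
    using cont by (auto simp: continuous_on_eq_continuous_within intro: continuous_within_subset)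
  \<comment> \<open>The density may take the value infinity, which \<open>enn2real\<close> turns
    into 0. Its integral over a bounded interval is finite, so this changes it there only on a null
    set.\<close>
  define g where "g x = enn2real (f x)" for x
  have [measurable]: "f \<in> borel_measurable borel" using f(1) by simp
  have E: "(\<integral>\<^sup>+ x. f x * indicator {a..b} x \<partial>lborel) = ennreal (F b - F a)" if "a \<le> b" for a b
  proof -
    have "emeasure ?m {a..b} = ennreal (F b - F a)"
      using that mono cont by (auto simp: mono_def intro!: emeasure_interval_measure_Icc)
    then show ?thesis
      unfolding f(2)[symmetric] by (subst (asm) emeasure_density) auto
  qed
  have I: "(g has_integral (F b - F a)) {a..b}" if ab: "a \<le> b" for a b
  proof -
    have ae: "AE x in lborel. f x * indicator {a..b} x \<noteq> \<infinity>"
      by (rule nn_integral_PInf_AE) (auto simp: E[OF ab])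
    have "(\<integral>\<^sup>+ x. ennreal (g x * indicator {a..b} x) \<partial>lborel) = (\<integral>\<^sup>+ x. f x * indicator {a..b} x \<partial>lborel)"
      using ae by (intro nn_integral_cong_AE)
        (auto simp: g_def indicator_def less_top)
    then have *: "(\<integral>\<^sup>+ x. ennreal (g x * indicator {a..b} x) \<partial>lborel) = ennreal (F b - F a)"
      using E[OF ab] by simp
    have "((\<lambda>x. g x * indicator {a..b} x) has_integral (F b - F a)) UNIV"
      by (rule nn_integral_has_integral)
        (use * monoD[OF mono ab] in \<open>auto simp: g_def\<close>)
    moreover have "(\<lambda>x. g x * indicator {a..b} x) = (\<lambda>x. if x \<in> {a..b} then g x else 0)"
      by (auto simp: indicator_def)
    ultimately show ?thesis by (simp only: has_integral_restrict_UNIV)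
  qed
  then show ?thesis using that by blast
qed

text \<open>Lebesgue's differentiation theorem in the form that averages over cubes having x as a
  corner; in dimension one these are intervals to the right of x.\<close>

lemma has_integral_right_derivative_ae:
  fixes F g :: "real \<Rightarrow> real"
  assumes int: "\<And>a b. a \<le> b \<Longrightarrow> (g has_integral (F b - F a)) {a..b}"
  obtains N where "negligible N" "\<And>x. x \<notin> N \<Longrightarrow> (F has_real_derivative g x) (at_right x)"
proof -
  have "g integrable_on cbox a b" for a b
    by (cases "a \<le> b") (use int in \<open>auto simp: has_integral_iff\<close>)
  then obtain N where N: "negligible N"
    "\<And>x e. \<lbrakk>x \<notin> N; 0 < e\<rbrakk> \<Longrightarrow> \<exists>d>0. \<forall>h. 0 < h \<and> h < d \<longrightarrow>
        norm (integral (cbox x (x + h *\<^sub>R One)) g /\<^sub>R h ^ DIM(real) - g x) < e"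
    using integrable_ccontinuous_explicit[of g] by metis
  have "(F has_real_derivative g x) (at_right x)" if x: "x \<notin> N" for x
    unfolding has_field_derivative_iff tendsto_iff
  proof (intro allI impI)
    fix e :: real assume "e > 0"
    then obtain d where d: "d > 0" "\<And>h. 0 < h \<and> h < d \<Longrightarrow> norm (integral (cbox x (x + h *\<^sub>R One)) g /\<^sub>R h ^ DIM(real) - g x) < e"
      using N(2)[OF x] by blast
    have "dist ((F y - F x) / (y - x)) (g x) < e" if y: "x < y" "y < x + d" for y
    proof -
      have "integral {x..y} g = F y - F x" using int[of x y] y by (simp add: has_integral_iff)
      then show ?thesis using d(2)[of "y - x"] y by (simp add: dist_norm divide_inverse_commute)
    qed
    then show "\<forall>\<^sub>F y in at_right x. dist ((F y - F x) / (y - x)) (g x) < e"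
      using d(1) by (auto simp: eventually_at_right_field intro!: exI[of _ "x + d"])
  qed
  then show ?thesis using that N(1) by blast
qed

lemma mono_Lipschitz_differentiable_ae:
  fixes F :: "real \<Rightarrow> real"
  assumes mono: "mono F" and lip: "1-lipschitz_on UNIV F"
  shows "negligible {x. \<not> F differentiable at x}"
proof -
  have comono: "mono (\<lambda>x. x - F x)"
  proof (rule monoI)
    fix x y :: real assume "x \<le> y"
    then show "x - F x \<le> y - F y"
      using lipschitz_onD[OF lip, of x y] monoD[OF mono, of x y] by (simp add: dist_real_def)
  qed
  have cont: "continuous_on UNIV F" using lip by (rule lipschitz_on_continuous_on)
  obtain g where g: "\<And>a b. a \<le> b \<Longrightarrow> (g has_integral (F b - F a)) {a..b}"
    using mono_Lipschitz_eq_integral[OF mono comono cont] by blast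
  obtain N where N: "negligible N" "\<And>x. x \<notin> N \<Longrightarrow> (F has_real_derivative g x) (at_right x)"
    using has_integral_right_derivative_ae[OF g] by blast
  \<comment> \<open>The averages over \<open>[x, x + h]\<close> only control right derivatives; reflection gives the left ones.\<close>
  define G where "G x = - F (- x)" for x
  have g': "((\<lambda>x. g (- x)) has_integral (G b - G a)) {a..b}" if "a \<le> b" for a b
    using has_integral_reflect_lemma_real[OF g[of "- b" "- a"]] that by (simp add: G_def)
  obtain N' where N': "negligible N'" "\<And>x. x \<notin> N' \<Longrightarrow> (G has_real_derivative g (- x)) (at_right x)"
    using has_integral_right_derivative_ae[OF g'] by blast
  have left: "(F has_real_derivative g x) (at_left x)" if "- x \<notin> N'" for x
  proof -
    have "(G has_real_derivative g x) (at (- x) within {-x<..})"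
      using N'(2)[OF that] by simp
    moreover have "((uminus :: real \<Rightarrow> real) has_real_derivative -1) (at x within {..<x})"
      by (auto intro!: derivative_eq_intros)
    moreover have "uminus ` {..<x} \<subseteq> {-x<..}" by auto
    ultimately have "((\<lambda>x. G (- x)) has_real_derivative (g x * -1)) (at_left x)"
      using DERIV_image_chain[of G "g x" uminus x "{..<x}" "-1"]
        DERIV_subset[of G "g x" "-x" "{-x<..}" "uminus ` {..<x}"] by (simp add: o_def)
    then have "((\<lambda>x. - G (- x)) has_real_derivative - (g x * -1)) (at_left x)"
      by (rule DERIV_minus)
    then show ?thesis by (simp add: G_def)
  qed
  have sub: "{x. \<not> F differentiable at x} \<subseteq> N \<union> uminus ` N'"
  proof
    fix x assume x: "x \<in> {x. \<not> F differentiable at x}"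
    show "x \<in> N \<union> uminus ` N'"
    proof (rule ccontr)
      assume "x \<notin> N \<union> uminus ` N'"
      then have "x \<notin> N" "- x \<notin> N'" by (auto simp: image_iff)
      then have "(F has_real_derivative g x) (at_right x)" "(F has_real_derivative g x) (at_left x)"
        using N left by auto
      then have "(F has_real_derivative g x) (at x)"
        unfolding has_field_derivative_iff by (rule filterlim_split_at_real[rotated])
      then show False using x by (auto simp: real_differentiable_def)
    qed
  qed
  have "negligible (uminus ` N')"
    by (rule negligible_differentiable_image_negligible)
      (auto simp: N' differentiable_on_def intro!: derivative_intros)
  with N(1) show ?thesis by (intro negligible_subset[OF _ sub]) auto
qed

section \<open>Null sets\<close>

lemma AE_lborel_iff_negligible:
  fixes P :: "'a::euclidean_space \<Rightarrow> bool"
  shows "(AE x in lborel. P x) \<longleftrightarrow> negligible {x. \<not> P x}"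
proof -
  have "(AE x in lborel. P x) \<longleftrightarrow> (AE x in lebesgue. P x)" by (simp add: AE_completion_iff)
  also have "\<dots> \<longleftrightarrow> {x. \<not> P x} \<in> null_sets lebesgue"
    unfolding eventually_ae_filter by (auto dest: null_sets_completion_subset)
  finally show ?thesis by (simp add: negligible_iff_null_sets)
qed

text \<open>Every line in direction \<open>e\<close> meets the preimage in a null set. By Fubini some translate of the
  preimage is null, hence so is the preimage.\<close>

lemma negligible_vimage_inner:
  fixes e :: "'a::euclidean_space"
  assumes "e \<noteq> 0" "negligible N"
  shows "negligible {x. x \<bullet> e \<in> N}"
proof -
  \<comment> \<open>Fubini needs a measurable set, so \<open>N\<close> is first enlarged to a Borel
    null set.\<close>
  from assms(2) have "N \<in> null_sets (completion lborel)"
    by (simp add: negligible_iff_null_sets)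
  then obtain N' where N': "N \<subseteq> N'" "N' \<in> null_sets lborel"
    unfolding null_sets_completion_iff2 by blast
  then have [measurable]: "N' \<in> sets borel" by (auto simp: null_sets_def)
  have c: "e \<bullet> e \<noteq> 0" using assms(1) by simp
  have "negligible N'" using N'(2) by (simp add: negligible_iff_null_sets null_sets_completionI)
  have 1: "AE t in lborel. (v + t *\<^sub>R e) \<bullet> e \<notin> N'" for v
  proof -
    \<comment> \<open>Along a line the inner product is affine in t with slope
      \<open>e \<bullet> e\<close>, so the bad t form an affine image of \<open>N'\<close>.\<close>
    have n: "negligible ((\<lambda>s. (1 / (e \<bullet> e)) *\<^sub>R (s - v \<bullet> e)) ` N')"
      by (rule negligible_differentiable_image_negligible)
        (auto intro!: derivative_intros simp: \<open>negligible N'\<close> assms(1) differentiable_on_def)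
    have "{t. (v + t *\<^sub>R e) \<bullet> e \<in> N'} \<subseteq> (\<lambda>s. (1 / (e \<bullet> e)) *\<^sub>R (s - v \<bullet> e)) ` N'"
    proof
      fix t assume "t \<in> {t. (v + t *\<^sub>R e) \<bullet> e \<in> N'}"
      then show "t \<in> (\<lambda>s. (1 / (e \<bullet> e)) *\<^sub>R (s - v \<bullet> e)) ` N'"
        using c by (intro image_eqI[of _ _ "(v + t *\<^sub>R e) \<bullet> e"]) (simp_all add: inner_add_left)
    qed
    from negligible_subset[OF n this] show ?thesis by (simp add: AE_lborel_iff_negligible)
  qed
  have m: "{z\<in>space (lborel \<Otimes>\<^sub>M lborel). (fst z + snd z *\<^sub>R e) \<bullet> e \<notin> N'} \<in> sets (lborel \<Otimes>\<^sub>M lborel)"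
    by measurable
  have "AE v in lborel. AE t in lborel. (v + t *\<^sub>R e) \<bullet> e \<notin> N'"
    using 1 by simp
  then have "AE t in (lborel :: real measure). AE v in (lborel :: 'a measure). (v + t *\<^sub>R e) \<bullet> e \<notin> N'"
    by (subst lborel_pair.AE_commute[OF m, symmetric])
  then obtain t where "AE v in (lborel :: 'a measure). (v + t *\<^sub>R e) \<bullet> e \<notin> N'"
    using eventually_happens'[of "ae_filter (lborel :: real measure)"] by (auto simp: ae_filter_eq_bot_iff)
  then have "negligible ((\<lambda>v. t *\<^sub>R e + v) ` {v. (v + t *\<^sub>R e) \<bullet> e \<in> N'})"
    by (intro negligible_translation) (simp add: AE_lborel_iff_negligible)
  then show ?thesis
  proof (rule negligible_subset)
    show "{x. x \<bullet> e \<in> N} \<subseteq> (\<lambda>v. t *\<^sub>R e + v) ` {v. (v + t *\<^sub>R e) \<bullet> e \<in> N'}"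
    proof
      fix x assume "x \<in> {x. x \<bullet> e \<in> N}"
      then show "x \<in> (\<lambda>v. t *\<^sub>R e + v) ` {v. (v + t *\<^sub>R e) \<bullet> e \<in> N'}"
        using N'(1) by (intro image_eqI[of _ _ "x - t *\<^sub>R e"]) auto
    qed
  qed
qed

text \<open>The matrix on the left has column j equal to \<open>a\<close> and zeros elsewhere. It is
  the normal vector of the hyperplane to which a prescribed score confines X.\<close>

lemma inner_matrix_column:
  fixes X :: "real ^ 'p ^ 'n"
  shows "X \<bullet> (\<chi> i. axis j (a i)) = (\<Sum>i\<in>UNIV. X $ i $ j * a i)"
  by (simp add: inner_vec_def axis_def if_distrib cong: if_cong)

lemma negligible_weighted_column_level:
  fixes \<psi> :: "real \<Rightarrow> real" and j :: "'p::finite"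
  assumes [continuous_intros]: "continuous_on UNIV \<psi>"
  shows "negligible ({(r, X).
     (\<Sum>i\<in>UNIV. X $ i $ j * \<psi> (r $ i)) = c \<and> (\<exists>i. \<psi> (r $ i) \<noteq> 0)} :: ((real ^ 'n) \<times> (real ^ 'p ^ 'n)) set)"
proof -
  let ?P = "\<lambda>(r :: real ^ 'n) (X :: real ^ 'p ^ 'n).
    \<not> ((\<Sum>i\<in>UNIV. X $ i $ j * \<psi> (r $ i)) = c \<and> (\<exists>i. \<psi> (r $ i) \<noteq> 0))"
  \<comment> \<open>The exceptional set is the intersection of a closed and an open set, hence
    Borel; Fubini can then be applied with r fixed.\<close>
  have "closed {z :: (real ^ 'n) \<times> (real ^ 'p ^ 'n). (\<Sum>i\<in>UNIV. snd z $ i $ j * \<psi> (fst z $ i)) = c}"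
    by (intro closed_Collect_eq continuous_intros continuous_on_compose2[OF assms]) auto
  moreover have "open {z :: (real ^ 'n) \<times> (real ^ 'p ^ 'n). \<exists>i. \<psi> (fst z $ i) \<noteq> 0}"
    by (intro open_Collect_ex open_Collect_neq continuous_intros continuous_on_compose2[OF assms]) auto
  ultimately have "{z. ?P (fst z) (snd z)} \<in> sets borel"
    by (subst Collect_neg_eq, subst Collect_conj_eq) (intro borel_comp sets.Int borel_closed borel_open)
  then have m: "{z\<in>space (lborel \<Otimes>\<^sub>M lborel). ?P (fst z) (snd z)} \<in> sets (lborel \<Otimes>\<^sub>M lborel)"
    unfolding lborel_prod by simp
  have "AE X in lborel. ?P r X" for r
  proof (cases "\<exists>i. \<psi> (r $ i) \<noteq> 0")
    case True
    define A :: "real ^ 'p ^ 'n" where "A = (\<chi> i. axis j (\<psi> (r $ i)))"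
    from True have "A \<noteq> 0" by (auto simp: A_def vec_eq_iff axis_def)
    then have "negligible {X. A \<bullet> X = c}" by (intro negligible_hyperplane) auto
    then show ?thesis
      using True by (auto simp: AE_lborel_iff_negligible A_def inner_commute inner_matrix_column)
  qed auto
  then have "AE z in lborel \<Otimes>\<^sub>M lborel. ?P (fst z) (snd z)"
    by (intro lborel_pair.AE_pair_measure m) auto
  then show ?thesis
    unfolding lborel_prod AE_lborel_iff_negligible by (rule negligible_subset) auto
qed

section \<open>Linear growth bounds at a point, and images of null sets\<close>

text \<open>One endpoint of the increment is fixed at x. This suffices for images of null sets to be
  null and, unlike a global Lipschitz bound, it is stable under products, which
  \<open>response\<close> contains.\<close>

definition pointwise_lipschitz :: "('a::real_normed_vector \<Rightarrow> 'b::real_normed_vector) \<Rightarrow> 'a \<Rightarrow> bool" where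
  "pointwise_lipschitz f x \<longleftrightarrow> (\<exists>B. \<forall>\<^sub>F y in nhds x. norm (f y - f x) \<le> B * norm (y - x))"

lemma pointwise_lipschitzE:
  assumes "pointwise_lipschitz f x"
  obtains B where "B \<ge> 0" "\<forall>\<^sub>F y in nhds x. norm (f y - f x) \<le> B * norm (y - x)"
proof -
  obtain B where B: "\<forall>\<^sub>F y in nhds x. norm (f y - f x) \<le> B * norm (y - x)"
    using assms by (auto simp: pointwise_lipschitz_def)
  have "\<forall>\<^sub>F y in nhds x. norm (f y - f x) \<le> \<bar>B\<bar> * norm (y - x)"
    using B
  proof eventually_elim
    case (elim y)
    then show ?case using mult_right_mono[OF abs_ge_self[of B] norm_ge_zero[of "y - x"]] by (rule order_trans)
  qed
  then show ?thesis using that[of "\<bar>B\<bar>"] by simp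
qed

lemma pointwise_lipschitz_bounded_linear:
  assumes "bounded_linear f"
  shows "pointwise_lipschitz f x"
proof -
  interpret bounded_linear f by fact
  obtain K where "\<And>x. norm (f x) \<le> norm x * K" using bounded by blast
  then show ?thesis
    unfolding pointwise_lipschitz_def by (intro exI[of _ K] always_eventually allI) (simp add: diff[symmetric] mult.commute)
qed

lemma pointwise_lipschitz_const: "pointwise_lipschitz (\<lambda>y. c) x"
  by (auto simp: pointwise_lipschitz_def intro!: exI[of _ 0])

lemma pointwise_lipschitz_add:
  assumes "pointwise_lipschitz f x" "pointwise_lipschitz g x"
  shows "pointwise_lipschitz (\<lambda>y. f y + g y) x"
proof -
  obtain A B where AB: "\<forall>\<^sub>F y in nhds x. norm (f y - f x) \<le> A * norm (y - x)"
    "\<forall>\<^sub>F y in nhds x. norm (g y - g x) \<le> B * norm (y - x)"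
    using assms by (auto simp: pointwise_lipschitz_def)
  have "\<forall>\<^sub>F y in nhds x. norm (f y + g y - (f x + g x)) \<le> (A + B) * norm (y - x)"
    using AB
  proof eventually_elim
    case (elim y)
    then show ?case
      using norm_triangle_ineq[of "f y - f x" "g y - g x"] by (simp add: algebra_simps)
  qed
  then show ?thesis by (auto simp: pointwise_lipschitz_def)
qed

lemma pointwise_lipschitz_sum:
  assumes "\<And>i. i \<in> I \<Longrightarrow> pointwise_lipschitz (f i) x"
  shows "pointwise_lipschitz (\<lambda>y. \<Sum>i\<in>I. f i y) x"
  using assms
proof (induction I rule: infinite_finite_induct)
  case (insert i I)
  then show ?case by (simp add: pointwise_lipschitz_add)
qed (simp_all add: pointwise_lipschitz_const)

lemma pointwise_lipschitz_bilinear: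
  assumes "bounded_bilinear b" "pointwise_lipschitz f x" "pointwise_lipschitz g x"
  shows "pointwise_lipschitz (\<lambda>y. b (f y) (g y)) x"
proof -
  interpret bounded_bilinear b by fact
  obtain A where A: "A \<ge> 0" "\<forall>\<^sub>F y in nhds x. norm (f y - f x) \<le> A * norm (y - x)"
    using pointwise_lipschitzE[OF assms(2)] .
  obtain B where B: "B \<ge> 0" "\<forall>\<^sub>F y in nhds x. norm (g y - g x) \<le> B * norm (y - x)"
    using pointwise_lipschitzE[OF assms(3)] .
  obtain K where K: "K \<ge> 0" "\<And>s t. norm (b s t) \<le> norm s * norm t * K"
    using nonneg_bounded by blast
  \<comment> \<open>The product of the two increments is quadratic in the distance; within distance
    1 it is bounded by a linear term.\<close>
  have near: "\<forall>\<^sub>F y in nhds x. norm (y - x) \<le> 1"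
    unfolding eventually_nhds_metric by (auto simp: dist_norm intro!: exI[of _ 1])
  have "\<forall>\<^sub>F y in nhds x. norm (b (f y) (g y) - b (f x) (g x))
      \<le> ((A * B + A * norm (g x) + norm (f x) * B) * K) * norm (y - x)"
    using A(2) B(2) near
  proof eventually_elim
    case (elim y)
    define t where "t = norm (y - x)"
    have t: "0 \<le> t" "t \<le> 1" using elim by (simp_all add: t_def)
    have "b (f y) (g y) - b (f x) (g x)
        = b (f y - f x) (g y - g x) + b (f y - f x) (g x) + b (f x) (g y - g x)"
      by (simp add: diff_left diff_right)
    also have "norm \<dots> \<le> norm (f y - f x) * norm (g y - g x) * K
        + norm (f y - f x) * norm (g x) * K + norm (f x) * norm (g y - g x) * K"
      by (intro norm_triangle_mono K(2))
    also have "\<dots> \<le> (A * t) * B * K + (A * t) * norm (g x) * K + norm (f x) * (B * t) * K"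
    proof (intro add_mono mult_right_mono mult_mono mult_left_mono)
      have "B * t \<le> B" using t B(1) by (simp add: mult_left_le)
      then show "norm (g y - g x) \<le> B" using elim(2) by (simp add: t_def)
    qed (use elim A(1) B(1) K(1) t in \<open>auto simp: t_def\<close>)
    also have "\<dots> = ((A * B + A * norm (g x) + norm (f x) * B) * K) * t" by (simp add: algebra_simps)
    finally show ?case by (simp add: t_def)
  qed
  then show ?thesis by (auto simp: pointwise_lipschitz_def)
qed

lemma pointwise_lipschitz_compose_lipschitz:
  assumes "C-lipschitz_on UNIV g" "pointwise_lipschitz f x"
  shows "pointwise_lipschitz (\<lambda>y. g (f y)) x"
proof -
  obtain A where A: "\<forall>\<^sub>F y in nhds x. norm (f y - f x) \<le> A * norm (y - x)"
    using assms(2) by (auto simp: pointwise_lipschitz_def)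
  have C: "C \<ge> 0" using assms(1) by (rule lipschitz_on_nonneg)
  have "\<forall>\<^sub>F y in nhds x. norm (g (f y) - g (f x)) \<le> (C * A) * norm (y - x)"
    using A
  proof eventually_elim
    case (elim y)
    have "norm (g (f y) - g (f x)) \<le> C * norm (f y - f x)"
      using lipschitz_onD[OF assms(1), of "f y" "f x"] by (simp add: dist_norm)
    also have "\<dots> \<le> C * (A * norm (y - x))" using elim C by (rule mult_left_mono)
    finally show ?case by (simp add: mult.assoc)
  qed
  then show ?thesis by (auto simp: pointwise_lipschitz_def)
qed

lemma pointwise_lipschitz_vec:
  fixes f :: "'i::finite \<Rightarrow> 'a::real_normed_vector \<Rightarrow> real"
  assumes "\<And>i. pointwise_lipschitz (f i) x"
  shows "pointwise_lipschitz (\<lambda>y. \<chi> i. f i y) x"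
proof -
  have "pointwise_lipschitz (\<lambda>y. \<Sum>i\<in>UNIV. f i y *\<^sub>R (axis i 1 :: real ^ 'i)) x"
    by (intro pointwise_lipschitz_sum pointwise_lipschitz_bilinear[OF bounded_bilinear_scaleR] assms
        pointwise_lipschitz_const)
  moreover have "(\<Sum>i\<in>UNIV. f i y *\<^sub>R (axis i 1 :: real ^ 'i)) = (\<chi> i. f i y)" for y
    by (simp add: vec_eq_iff axis_def if_distrib if_distribR cong: if_cong)
  ultimately show ?thesis by simp
qed

lemma pointwise_lipschitz_Pair:
  assumes "pointwise_lipschitz f x" "pointwise_lipschitz g x"
  shows "pointwise_lipschitz (\<lambda>y. (f y, g y)) x"
proof -
  obtain A B where AB: "\<forall>\<^sub>F y in nhds x. norm (f y - f x) \<le> A * norm (y - x)"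
    "\<forall>\<^sub>F y in nhds x. norm (g y - g x) \<le> B * norm (y - x)"
    using assms by (auto simp: pointwise_lipschitz_def)
  have "\<forall>\<^sub>F y in nhds x. norm ((f y, g y) - (f x, g x)) \<le> (A + B) * norm (y - x)"
    using AB
  proof eventually_elim
    case (elim y)
    then show ?case
      using norm_Pair_le[of "f y - f x" "g y - g x"] by (simp add: algebra_simps)
  qed
  then show ?thesis by (auto simp: pointwise_lipschitz_def)
qed

lemma negligible_pointwise_lipschitz_image:
  fixes f :: "'a::euclidean_space \<Rightarrow> 'b::euclidean_space"
  assumes "DIM('a) \<le> DIM('b)" "negligible S" "\<And>x. x \<in> S \<Longrightarrow> pointwise_lipschitz f x"
  shows "negligible (f ` S)"
proof (rule negligible_locally_Lipschitz_image[OF assms(1,2)])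
  fix x assume "x \<in> S"
  then show "\<exists>T B. open T \<and> x \<in> T \<and> (\<forall>y\<in>S \<inter> T. norm (f y - f x) \<le> B * norm (y - x))"
    using assms(3)[of x] unfolding pointwise_lipschitz_def eventually_nhds by blast
qed

section \<open>Derivatives\<close>

text \<open>Since \<open>f\<close> moves by at most a multiple of the distance, the o(.) remainder
  of \<open>g\<close> at \<open>f x\<close> is also o(.) in y. Differentiability of \<open>f\<close>
  is not assumed: its unknown first-order part is subtracted with the factor
  \<open>d\<close>.\<close>

lemma has_derivative_compose_Lipschitz_remainder:
  fixes f :: "'a::real_normed_vector \<Rightarrow> real"
  assumes g: "(g has_real_derivative d) (at (f x))"
    and f: "\<And>y. \<bar>f y - f x\<bar> \<le> L * norm (y - x)"
  shows "((\<lambda>y. g (f y) - d * f y) has_derivative (\<lambda>h. 0)) (at x)"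
  unfolding has_derivative_at_alt
proof (intro conjI allI impI bounded_linear_zero)
  fix e :: real assume e: "e > 0"
  \<comment> \<open>Adding 1 makes the constant positive, so that it can be divided by.\<close>
  define K where "K = \<bar>L\<bar> + 1"
  have K: "K > 0" by (simp add: K_def add_nonneg_pos)
  have fK: "\<bar>f y - f x\<bar> \<le> K * norm (y - x)" for y
  proof -
    have "L * norm (y - x) \<le> K * norm (y - x)" by (intro mult_right_mono) (auto simp: K_def)
    then show ?thesis using f[of y] by simp
  qed
  have "e / K > 0" using e K by simp
  then obtain \<delta> where \<delta>: "\<delta> > 0"
    "\<And>s. norm (s - f x) < \<delta> \<Longrightarrow> norm (g s - g (f x) - d * (s - f x)) \<le> (e / K) * norm (s - f x)"
    using g unfolding has_field_derivative_def has_derivative_at_alt by blast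
  show "\<exists>\<delta>>0. \<forall>y. norm (y - x) < \<delta> \<longrightarrow>
    norm (g (f y) - d * f y - (g (f x) - d * f x) - 0) \<le> e * norm (y - x)"
  proof (intro exI conjI allI impI)
    show "\<delta> / K > 0" using \<delta>(1) K by simp
    fix y assume "norm (y - x) < \<delta> / K"
    then have "K * norm (y - x) < \<delta>" using K by (simp add: field_simps)
    then have "norm (f y - f x) < \<delta>" using fK[of y] by simp
    from \<delta>(2)[OF this] have "norm (g (f y) - g (f x) - d * (f y - f x)) \<le> (e / K) * \<bar>f y - f x\<bar>" by simp
    also have "\<dots> \<le> (e / K) * (K * norm (y - x))"
      using e K fK by (intro mult_left_mono) auto
    also have "\<dots> = e * norm (y - x)" using K by simp
    finally show "norm (g (f y) - d * f y - (g (f x) - d * f x) - 0) \<le> e * norm (y - x)"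
      by (simp add: algebra_simps)
  qed
qed

text \<open>Serves the kink: a nonexpansive function may fail to be differentiable, yet it preserves
  constancy to first order.\<close>

lemma has_derivative_zero_dominated:
  fixes f g :: "'a::real_normed_vector \<Rightarrow> real"
  assumes "(f has_derivative (\<lambda>h. 0)) (at x)" "\<And>y. \<bar>g y - g x\<bar> \<le> \<bar>f y - f x\<bar>"
  shows "(g has_derivative (\<lambda>h. 0)) (at x)"
  unfolding has_derivative_at_alt
proof (intro conjI allI impI bounded_linear_zero)
  fix e :: real assume "e > 0"
  then obtain \<delta> where "\<delta> > 0" "\<And>y. norm (y - x) < \<delta> \<Longrightarrow> norm (f y - f x - 0) \<le> e * norm (y - x)"
    using assms(1) unfolding has_derivative_at_alt by blast
  then show "\<exists>\<delta>>0. \<forall>y. norm (y - x) < \<delta> \<longrightarrow> norm (g y - g x - 0) \<le> e * norm (y - x)"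
    using assms(2) by (intro exI[of _ \<delta>]) (auto intro: order_trans)
qed

lemma has_derivative_componentI:
  fixes f :: "'a::real_normed_vector \<Rightarrow> real ^ 'n"
  assumes "\<And>i. ((\<lambda>x. f x $ i) has_derivative (\<lambda>h. f' h $ i)) F"
  shows "(f has_derivative f') F"
proof -
  have sum: "(\<Sum>i\<in>UNIV. v $ i *\<^sub>R axis i 1) = v" for v :: "real ^ 'n"
    by (simp add: vec_eq_iff axis_def if_distrib if_distribR cong: if_cong)
  have "((\<lambda>x. \<Sum>i\<in>UNIV. f x $ i *\<^sub>R axis i (1 :: real)) has_derivative
      (\<lambda>h. \<Sum>i\<in>UNIV. f' h $ i *\<^sub>R axis i (1 :: real))) F"
    by (intro has_derivative_sum has_derivative_scaleR_left assms)
  then show ?thesis unfolding sum .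
qed

section \<open>Soft thresholding\<close>

definition soft_threshold :: "real \<Rightarrow> real \<Rightarrow> real" where
  "soft_threshold c u = (if u > c then u - c else if u < - c then u + c else 0)"

text \<open>Component j of X^T \<psi>(r), which is -n times the partial derivative of the averaged
  loss in b_j.\<close>

definition score :: "(real \<Rightarrow> real) \<Rightarrow> real ^ 'p ^ 'n \<Rightarrow> real ^ 'n \<Rightarrow> 'p \<Rightarrow> real" where
  "score \<psi> X r j = (\<Sum>i\<in>UNIV. X $ i $ j * \<psi> (r $ i))"

lemma soft_threshold_diff_between:
  assumes "c \<ge> 0" "u \<le> v"
  shows "0 \<le> soft_threshold c v - soft_threshold c u" "soft_threshold c v - soft_threshold c u \<le> v - u"
  by (cases "u > c"; cases "u < - c"; cases "v > c"; cases "v < - c";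
      simp only: soft_threshold_def if_True if_False; use assms in linarith)+

lemma soft_threshold_nonexpansive:
  "c \<ge> 0 \<Longrightarrow> \<bar>soft_threshold c u - soft_threshold c v\<bar> \<le> \<bar>u - v\<bar>"
  using soft_threshold_diff_between[of c u v] soft_threshold_diff_between[of c v u] by linarith

text \<open>The increment of the soft threshold has the sign of \<open>u - v\<close> and at most its
  size. In this product form the bounds for different j can be summed into one inner product in
  \<open>elastic_net_Lipschitz\<close>.\<close>

lemma soft_threshold_firmly_nonexpansive:
  assumes "c \<ge> 0"
  shows "(soft_threshold c u - soft_threshold c v)\<^sup>2
    \<le> (soft_threshold c u - soft_threshold c v) * (u - v)"
proof (cases "u \<le> v")
  case True
  then show ?thesis
    using soft_threshold_diff_between[OF assms, of u v] unfolding power2_eq_square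
    by (intro mult_left_mono_neg) auto
next
  case False
  then show ?thesis
    using soft_threshold_diff_between[OF assms, of v u] unfolding power2_eq_square
    by (intro mult_left_mono) auto
qed

lemma soft_threshold_eq_0_iff: "c \<ge> 0 \<Longrightarrow> soft_threshold c u = 0 \<longleftrightarrow> \<bar>u\<bar> \<le> c"
  by (auto simp: soft_threshold_def)

lemma soft_threshold_has_derivative:
  assumes "c \<ge> 0" "\<bar>u\<bar> \<noteq> c"
  shows "(soft_threshold c has_real_derivative (if soft_threshold c u = 0 then 0 else 1)) (at u)"
proof -
  consider "u > c" | "u < - c" | "- c < u" "u < c" using assms by linarith
  then show ?thesis
  proof cases
    case 1
    have "((\<lambda>x. x - c) has_real_derivative 1) (at u)" by (auto intro!: derivative_eq_intros)
    then have "(soft_threshold c has_real_derivative 1) (at u)"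
      by (rule has_field_derivative_transform_within_open[where S = "{c<..}"])
        (use 1 in \<open>auto simp: soft_threshold_def\<close>)
    then show ?thesis using 1 assms by (simp add: soft_threshold_eq_0_iff)
  next
    case 2
    have "((\<lambda>x. x + c) has_real_derivative 1) (at u)" by (auto intro!: derivative_eq_intros)
    then have "(soft_threshold c has_real_derivative 1) (at u)"
      by (rule has_field_derivative_transform_within_open[where S = "{..<-c}"])
        (use 2 assms in \<open>auto simp: soft_threshold_def\<close>)
    then show ?thesis using 2 assms by (simp add: soft_threshold_eq_0_iff)
  next
    case 3
    have "((\<lambda>x. 0) has_real_derivative 0) (at u)" by simp
    then have "(soft_threshold c has_real_derivative 0) (at u)"
      by (rule has_field_derivative_transform_within_open[where S = "{-c<..<c}"])
        (use 3 in \<open>auto simp: soft_threshold_def\<close>)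
    moreover have "\<bar>u\<bar> \<le> c" using 3 by simp
    ultimately show ?thesis using assms by (simp add: soft_threshold_eq_0_iff)
  qed
qed

section \<open>Stationarity in one coordinate, and convexity on the line\<close>

text \<open>Away from 0 the absolute value is locally linear and the minimum is an ordinary critical
  point; at 0 the difference quotients from the two sides bound \<open>d\<close>.\<close>

lemma abs_penalised_minimum_stationary:
  fixes q :: "real \<Rightarrow> real"
  assumes q: "(q has_real_derivative d) (at 0)" and c: "c \<ge> 0"
    and min: "\<And>t. q 0 + c * \<bar>b\<bar> \<le> q t + c * \<bar>b + t\<bar>"
  shows "(b > 0 \<longrightarrow> d + c = 0) \<and> (b < 0 \<longrightarrow> d - c = 0) \<and> \<bar>d\<bar> \<le> c"
proof -
  have pos: "d + c = 0" if b: "b > 0"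
  proof (rule DERIV_local_min[where d = b])
    show "((\<lambda>t. q t + c * (b + t)) has_real_derivative d + c) (at 0)"
      by (auto intro!: derivative_eq_intros q)
    show "\<forall>y. \<bar>0 - y\<bar> < b \<longrightarrow> q 0 + c * (b + 0) \<le> q y + c * (b + y)"
    proof (intro allI impI)
      fix y assume "\<bar>0 - y\<bar> < b"
      then show "q 0 + c * (b + 0) \<le> q y + c * (b + y)" using min[of y] b by (simp add: abs_if split: if_splits)
    qed
  qed (rule b)
  have neg: "d - c = 0" if b: "b < 0"
  proof (rule DERIV_local_min[where d = "- b"])
    show "((\<lambda>t. q t - c * (b + t)) has_real_derivative d - c) (at 0)"
      by (auto intro!: derivative_eq_intros q)
    show "\<forall>y. \<bar>0 - y\<bar> < - b \<longrightarrow> q 0 - c * (b + 0) \<le> q y - c * (b + y)"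
    proof (intro allI impI)
      fix y assume "\<bar>0 - y\<bar> < - b"
      then show "q 0 - c * (b + 0) \<le> q y - c * (b + y)" using min[of y] b
        by (simp add: abs_if algebra_simps split: if_splits)
    qed
  qed (use b in simp)
  have zero: "\<bar>d\<bar> \<le> c" if b: "b = 0"
  proof -
    have lim: "((\<lambda>t. (q t - q 0) / t) \<longlongrightarrow> d) (at 0)"
      using q by (simp add: has_field_derivative_iff)
    have "- c \<le> d"
    proof (rule tendsto_lowerbound)
      show "((\<lambda>t. (q t - q 0) / t) \<longlongrightarrow> d) (at_right 0)"
        using lim by (rule filterlim_at_split[THEN iffD1, THEN conjunct2])
      show "\<forall>\<^sub>F t in at_right 0. - c \<le> (q t - q 0) / t"
        using eventually_at_right_less[of 0]
      proof eventually_elim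
        case (elim t)
        then show ?case using min[of t] b by (simp add: field_simps)
      qed
    qed simp
    moreover have "d \<le> c"
    proof (rule tendsto_upperbound)
      show "((\<lambda>t. (q t - q 0) / t) \<longlongrightarrow> d) (at_left 0)"
        using lim by (rule filterlim_at_split[THEN iffD1, THEN conjunct1])
      have "\<forall>\<^sub>F t in at_left 0. t < (0::real)" by (simp add: eventually_at_filter)
      then show "\<forall>\<^sub>F t in at_left 0. (q t - q 0) / t \<le> c"
      proof eventually_elim
        case (elim t)
        then show ?case using min[of t] b by (simp add: field_simps)
      qed
    qed simp
    ultimately show ?thesis by simp
  qed
  show ?thesis using pos neg zero c by (cases b "0::real" rule: linorder_cases) auto
qed

lemma convex_on_real_tangent:
  fixes \<rho> \<psi> :: "real \<Rightarrow> real"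
  assumes "convex_on UNIV \<rho>" "\<And>t. (\<rho> has_real_derivative \<psi> t) (at t)"
  shows "\<rho> s + \<psi> s * (t - s) \<le> \<rho> t"
  using convex_on_imp_above_tangent[OF assms(1), of s t "\<psi> s"] assms(2)[of s]
  by simp

lemma convex_on_real_derivative_mono:
  fixes \<rho> \<psi> :: "real \<Rightarrow> real"
  assumes "convex_on UNIV \<rho>" "\<And>t. (\<rho> has_real_derivative \<psi> t) (at t)"
  shows "mono \<psi>"
proof (rule monoI)
  fix s t :: real assume "s \<le> t"
  have "(\<psi> t - \<psi> s) * (t - s) \<ge> 0"
    using convex_on_real_tangent[OF assms, of s t] convex_on_real_tangent[OF assms, of t s]
    by (simp add: algebra_simps)
  with \<open>s \<le> t\<close> show "\<psi> s \<le> \<psi> t"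
    by (cases "s = t") (auto simp: zero_le_mult_iff)
qed

section \<open>The active block of the Gram matrix\<close>

text \<open>The rows outside \<open>S\<close> are zeroed instead of removed, which keeps a fixed
  type while \<open>S\<close> varies with (y, X).\<close>

definition masked_transpose :: "real ^ 'p ^ 'n \<Rightarrow> 'p set \<Rightarrow> real ^ 'n ^ 'p" where
  "masked_transpose X S = (\<chi> k i. if k \<in> S then X $ i $ k else 0)"

text \<open>Only the left factor is masked. This is the form that linearised stationarity takes: the
  residual contains all of \<open>X *v b\<close>, whereas the equations for inactive coordinates
  lose their right-hand side.\<close>

definition active_gram :: "real \<Rightarrow> real ^ 'p ^ 'n \<Rightarrow> 'p set \<Rightarrow> real ^ 'n ^ 'n \<Rightarrow> real ^ 'p ^ 'p" where
  "active_gram \<mu> X S D = mat (real CARD('n) * \<mu>) + masked_transpose X S ** (D ** X)"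

lemma diag_matrix_vector_mult: "(diag_matrix d *v v) $ i = d $ i * v $ i"
  by (simp add: diag_matrix_def matrix_vector_mult_def if_distrib if_distribR cong: if_cong)

lemma diag_matrix_mult: "diag_matrix d ** diag_matrix e = diag_matrix (\<chi> i. d $ i * e $ i)"
proof -
  have "(\<Sum>k\<in>UNIV. (if i = k then d $ i else 0) * (if k = j then e $ k else 0)) =
    (\<Sum>k\<in>UNIV. if k = i then (if i = j then d $ i * e $ i else 0) else 0)" for i j
    by (intro sum.cong) auto
  then show ?thesis by (auto simp: diag_matrix_def matrix_matrix_mult_def vec_eq_iff)
qed

lemma masked_transpose_vector_mult:
  "(masked_transpose X S *v v) $ k = (if k \<in> S then \<Sum>i\<in>UNIV. X $ i $ k * v $ i else 0)"
  by (simp add: masked_transpose_def matrix_vector_mult_def)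

lemma mat_vector_mult: "mat (c :: real) *v v = c *\<^sub>R v"
  by (simp add: mat_def matrix_vector_mult_def vec_eq_iff if_distrib if_distribR cong: if_cong)

lemma active_gram_vector_mult:
  fixes X :: "real ^ 'p ^ 'n"
  shows "active_gram \<mu> X S D *v b = (real CARD('n) * \<mu>) *\<^sub>R b + masked_transpose X S *v (D *v (X *v b))"
  by (simp add: active_gram_def matrix_vector_mult_add_rdistrib mat_vector_mult matrix_vector_mul_assoc matrix_mul_assoc)

lemma inner_masked_transpose_vector_mult:
  assumes "\<And>j. j \<notin> S \<Longrightarrow> b $ j = 0"
  shows "b \<bullet> (masked_transpose X S *v v) = (X *v b) \<bullet> v"
proof -
  have "b \<bullet> (masked_transpose X S *v v) = (\<Sum>j\<in>UNIV. \<Sum>i\<in>UNIV. b $ j * X $ i $ j * v $ i)"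
    unfolding inner_vec_def using assms
    by (intro sum.cong) (auto simp: masked_transpose_vector_mult sum_distrib_left mult.assoc)
  also have "\<dots> = (X *v b) \<bullet> v"
    by (subst sum.swap) (simp add: inner_vec_def matrix_vector_mult_def sum_distrib_left sum_distrib_right mult.commute mult.left_commute)
  finally show ?thesis .
qed

lemma invertible_matrix_inv:
  assumes "invertible A"
  shows "A ** matrix_inv A = mat 1" "matrix_inv A ** A = mat 1"
  using assms unfolding matrix_inv_def invertible_def by (metis (mono_tags, lifting) someI_ex)+

text \<open>The matrix is not symmetric in general, so its kernel is treated in two steps: the rows
  outside \<open>S\<close> force b to be supported on \<open>S\<close>, and for such b the quadratic
  form is n \<mu> |b|^2 plus a nonnegative term.\<close>

lemma active_gram_invertible:
  fixes X :: "real ^ 'p ^ 'n"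
  assumes mu: "\<mu> > 0" and d: "\<And>i. d $ i \<ge> 0"
  shows "invertible (active_gram \<mu> X S (diag_matrix d))"
proof -
  let ?M = "active_gram \<mu> X S (diag_matrix d)"
  have n: "real CARD('n) * \<mu> > 0" using mu by simp
  have "b = 0" if b: "?M *v b = 0" for b
  proof -
    have supp: "b $ j = 0" if "j \<notin> S" for j
    proof -
      have "(?M *v b) $ j = real CARD('n) * \<mu> * b $ j"
        using that by (simp add: active_gram_vector_mult masked_transpose_vector_mult)
      then show ?thesis using b mu by simp
    qed
    have "0 = b \<bullet> (?M *v b)" using b by simp
    also have "\<dots> = real CARD('n) * \<mu> * (b \<bullet> b) + (X *v b) \<bullet> (diag_matrix d *v (X *v b))"
      by (simp add: active_gram_vector_mult inner_add_right inner_masked_transpose_vector_mult[OF supp])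
    finally have "real CARD('n) * \<mu> * (b \<bullet> b) = - ((X *v b) \<bullet> (diag_matrix d *v (X *v b)))" by simp
    moreover have "(X *v b) \<bullet> (diag_matrix d *v (X *v b)) \<ge> 0"
      unfolding inner_vec_def using d
      by (intro sum_nonneg) (simp add: diag_matrix_vector_mult mult.left_commute[of _ "d $ _"])
    ultimately have "real CARD('n) * \<mu> * (b \<bullet> b) \<le> 0" by simp
    then have "b \<bullet> b \<le> 0" using n mu by (simp add: mult_le_0_iff)
    then have "b \<bullet> b = 0" using inner_ge_zero[of b] by linarith
    then show ?thesis by simp
  qed
  then show ?thesis
    unfolding invertible_left_inverse matrix_left_invertible_ker by blast
qed

text \<open>Uniqueness is C = C (A B) = (C A) B = B on the index set; extensionality extends the
  equality to all arguments.\<close>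

lemma set_mat_inverse_eqI:
  fixes A B :: "('a, 'a) set_mat"
  assumes "finite J" and ext: "B \<in> J \<rightarrow>\<^sub>E (J \<rightarrow>\<^sub>E UNIV)"
    and inv: "\<And>i k. i \<in> J \<Longrightarrow> k \<in> J \<Longrightarrow> set_mat_mult J A B i k = set_mat_ident i k"
      "\<And>i k. i \<in> J \<Longrightarrow> k \<in> J \<Longrightarrow> set_mat_mult J B A i k = set_mat_ident i k"
  shows "set_mat_inverse J A = B"
  unfolding set_mat_inverse_def
proof (rule the_equality)
  show "B \<in> J \<rightarrow>\<^sub>E (J \<rightarrow>\<^sub>E UNIV) \<and> (\<forall>i\<in>J. \<forall>k\<in>J.
     set_mat_mult J A B i k = set_mat_ident i k \<and> set_mat_mult J B A i k = set_mat_ident i k)"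
    using ext inv by auto
next
  fix C assume C: "C \<in> J \<rightarrow>\<^sub>E (J \<rightarrow>\<^sub>E UNIV) \<and> (\<forall>i\<in>J. \<forall>k\<in>J.
     set_mat_mult J A C i k = set_mat_ident i k \<and> set_mat_mult J C A i k = set_mat_ident i k)"
  have eq: "C i k = B i k" if i: "i \<in> J" and k: "k \<in> J" for i k
  proof -
    have "C i k = (\<Sum>j\<in>J. C i j * set_mat_ident j k)"
      using assms(1) k by (simp add: set_mat_ident_def if_distrib if_distribR cong: if_cong)
    also have "\<dots> = (\<Sum>j\<in>J. C i j * set_mat_mult J A B j k)"
      using inv(1) k by (intro sum.cong) auto
    also have "\<dots> = (\<Sum>l\<in>J. set_mat_mult J C A i l * B l k)"
      unfolding set_mat_mult_def sum_distrib_left sum_distrib_right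
      by (subst sum.swap) (simp add: mult.assoc)
    also have "\<dots> = (\<Sum>l\<in>J. set_mat_ident i l * B l k)"
      using C i by (intro sum.cong) auto
    also have "\<dots> = B i k"
      using assms(1) i by (simp add: set_mat_ident_def if_distrib if_distribR cong: if_cong)
    finally show ?thesis .
  qed
  show "C = B"
  proof (rule PiE_ext[of _ J "\<lambda>_. J \<rightarrow>\<^sub>E UNIV"])
    fix i assume i: "i \<in> J"
    show "C i = B i"
      by (rule PiE_ext[of _ J "\<lambda>_. UNIV"]) (use C ext i eq in auto)
  qed (use C ext in auto)
qed

text \<open>Outside \<open>S\<close> the rows of \<^const>\<open>active_gram\<close> are those of a multiple of the identity, so the
  matrix is block triangular and the \<open>S \<times> S\<close> block of its inverse inverts its \<open>S \<times> S\<close> block.\<close>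

lemma active_resolvent_eq:
  fixes X :: "real ^ 'p ^ 'n"
  assumes "\<mu> > 0" "\<And>i. d $ i \<ge> 0"
  shows "active_resolvent \<mu> X S (diag_matrix d) =
    X ** matrix_inv (active_gram \<mu> X S (diag_matrix d)) ** masked_transpose X S"
proof -
  define M where "M = active_gram \<mu> X S (diag_matrix d)"
  define B where "B = matrix_inv M"
  define G where "G = set_mat_add (set_mat_mult UNIV (set_mat_transpose (column_submatrix X S))
      (set_mat_mult UNIV (entries (diag_matrix d)) (column_submatrix X S)))
      (set_mat_scale (real CARD('n) * \<mu>) set_mat_ident)"
  have n: "real CARD('n) * \<mu> > 0" using assms by simp
  have "invertible M" unfolding M_def by (rule active_gram_invertible) fact+
  then have MB: "M ** B = mat 1" and BM: "B ** M = mat 1"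
    unfolding B_def by (rule invertible_matrix_inv)+
  have M_in: "M $ j $ k = G j k" if "j \<in> S" "k \<in> S" for j k
    using that
    by (simp add: M_def G_def active_gram_def masked_transpose_def set_mat_add_def set_mat_mult_def
        set_mat_transpose_def column_submatrix_def entries_def set_mat_scale_def set_mat_ident_def
        matrix_matrix_mult_def mat_def)
  have M_out: "M $ j $ k = (if j = k then real CARD('n) * \<mu> else 0)" if "j \<notin> S" for j k
    using that by (simp add: M_def active_gram_def masked_transpose_def matrix_matrix_mult_def mat_def)
  have B_out: "B $ j $ k = 0" if "j \<notin> S" "k \<in> S" for j k
  proof -
    have "(M ** B) $ j $ k = real CARD('n) * \<mu> * B $ j $ k"
      using that by (simp add: matrix_matrix_mult_def M_out if_distrib if_distribR cong: if_cong)
    moreover have "(M ** B) $ j $ k = 0" using that unfolding MB by (auto simp: mat_def)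
    ultimately show ?thesis using assms(1) by simp
  qed
  \<comment> \<open>The sums over \<open>S\<close> extend to all indices for different reasons: in
    the product with \<open>B\<close> on the right, \<open>B\<close> vanishes at the added rows by
    \<open>B_out\<close>; with \<open>B\<close> on the left, \<open>M\<close> does by
    \<open>M_out\<close>.\<close>
  have inv: "set_mat_inverse S G = (\<lambda>j\<in>S. \<lambda>k\<in>S. B $ j $ k)"
  proof (rule set_mat_inverse_eqI)
    fix i k assume ik: "i \<in> S" "k \<in> S"
    have "set_mat_mult S G (\<lambda>j\<in>S. \<lambda>k\<in>S. B $ j $ k) i k = (\<Sum>j\<in>S. M $ i $ j * B $ j $ k)"
      unfolding set_mat_mult_def using ik by (intro sum.cong) (auto simp: M_in)
    also have "\<dots> = (\<Sum>j\<in>UNIV. M $ i $ j * B $ j $ k)"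
      using ik by (intro sum.mono_neutral_left) (auto simp: B_out)
    also have "\<dots> = (M ** B) $ i $ k" by (simp add: matrix_matrix_mult_def)
    finally show "set_mat_mult S G (\<lambda>j\<in>S. \<lambda>k\<in>S. B $ j $ k) i k = set_mat_ident i k"
      unfolding MB by (simp add: mat_def set_mat_ident_def)
    have "set_mat_mult S (\<lambda>j\<in>S. \<lambda>k\<in>S. B $ j $ k) G i k = (\<Sum>j\<in>S. B $ i $ j * M $ j $ k)"
      unfolding set_mat_mult_def using ik by (intro sum.cong) (auto simp: M_in)
    also have "\<dots> = (\<Sum>j\<in>UNIV. B $ i $ j * M $ j $ k)"
      using ik by (intro sum.mono_neutral_left) (auto simp: M_out)
    also have "\<dots> = (B ** M) $ i $ k" by (simp add: matrix_matrix_mult_def)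
    finally show "set_mat_mult S (\<lambda>j\<in>S. \<lambda>k\<in>S. B $ j $ k) G i k = set_mat_ident i k"
      unfolding BM by (simp add: mat_def set_mat_ident_def)
  qed auto
  have "active_resolvent \<mu> X S (diag_matrix d) $ a $ i = (X ** (B ** masked_transpose X S)) $ a $ i" for a i
  proof -
    have "active_resolvent \<mu> X S (diag_matrix d) $ a $ i
        = (\<Sum>j\<in>S. X $ a $ j * (\<Sum>k\<in>S. B $ j $ k * X $ i $ k))"
      unfolding active_resolvent_def Let_def G_def[symmetric] inv
      by (simp add: of_entries_def set_mat_mult_def set_mat_transpose_def column_submatrix_def)
    also have "\<dots> = (\<Sum>j\<in>S. X $ a $ j * (B ** masked_transpose X S) $ j $ i)"
    proof (intro sum.cong refl arg_cong2[where f = "(*)"])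
      fix j
      show "(\<Sum>k\<in>S. B $ j $ k * X $ i $ k) = (B ** masked_transpose X S) $ j $ i"
        by (simp add: matrix_matrix_mult_def masked_transpose_def if_distrib sum.If_cases cong: if_cong)
    qed
    also have "\<dots> = (\<Sum>j\<in>UNIV. X $ a $ j * (B ** masked_transpose X S) $ j $ i)"
      by (intro sum.mono_neutral_left)
        (auto simp: matrix_matrix_mult_def masked_transpose_def B_out intro!: sum.neutral)
    finally show ?thesis by (simp add: matrix_matrix_mult_def)
  qed
  then show ?thesis by (simp add: vec_eq_iff B_def M_def matrix_mul_assoc)
qed

section \<open>The elastic net\<close>

locale elastic_net_problem =
  fixes \<rho> \<psi> :: "real \<Rightarrow> real" and \<mu> lam :: real
  assumes convex: "convex_on UNIV \<rho>"
    and deriv: "\<And>t. (\<rho> has_real_derivative \<psi> t) (at t)"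
    and lipschitz: "1-lipschitz_on UNIV \<psi>"
    and mu_pos: "\<mu> > 0" and lam_nonneg: "lam \<ge> 0"
begin

lemma mono_psi: "mono \<psi>"
  using convex_on_real_derivative_mono[OF convex deriv] .

section \<open>Existence of the minimizer, and its stationarity condition\<close>

text \<open>Each loss lies above its tangent at \<open>y $ i\<close>, that is at b = 0, and this
  bound is affine in b; the quadratic penalty then gives coercivity.\<close>

lemma elastic_net_objective_lower_bound:
  fixes y :: "real ^ 'n" and X :: "real ^ 'p ^ 'n"
  obtains C K where "C \<ge> 0" "\<And>b. elastic_net_objective \<rho> \<mu> lam y X b \<ge> \<mu> * (norm b)\<^sup>2 / 2 - C * norm b - K"
proof -
  define v where "v = (\<Sum>i\<in>UNIV. \<psi> (y $ i) *\<^sub>R row i X)"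
  define n where "n = real CARD('n)"
  have n: "n > 0" by (simp add: n_def)
  have "elastic_net_objective \<rho> \<mu> lam y X b \<ge> \<mu> * (norm b)\<^sup>2 / 2 - (norm v / n) * norm b - (- (\<Sum>i\<in>UNIV. \<rho> (y $ i)) / n)" for b
  proof -
    have "(\<Sum>i\<in>UNIV. \<rho> (y $ i) - \<psi> (y $ i) * (row i X \<bullet> b)) \<le> (\<Sum>i\<in>UNIV. \<rho> (y $ i - row i X \<bullet> b))"
    proof (rule sum_mono)
      fix i show "\<rho> (y $ i) - \<psi> (y $ i) * (row i X \<bullet> b) \<le> \<rho> (y $ i - row i X \<bullet> b)"
        using convex_on_real_tangent[OF convex deriv, of "y $ i" "y $ i - row i X \<bullet> b"] by simp
    qed
    moreover have "(\<Sum>i\<in>UNIV. \<psi> (y $ i) * (row i X \<bullet> b)) = v \<bullet> b"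
      by (simp add: v_def inner_sum_left)
    moreover have "v \<bullet> b \<le> norm v * norm b" by (rule norm_cauchy_schwarz)
    ultimately have "(\<Sum>i\<in>UNIV. \<rho> (y $ i)) - norm v * norm b \<le> (\<Sum>i\<in>UNIV. \<rho> (y $ i - row i X \<bullet> b))"
      by (simp add: sum_subtractf)
    then have "((\<Sum>i\<in>UNIV. \<rho> (y $ i)) - norm v * norm b) / n \<le> (\<Sum>i\<in>UNIV. \<rho> (y $ i - row i X \<bullet> b)) / n"
      using n by (intro divide_right_mono) auto
    moreover have "0 \<le> lam * (\<Sum>j\<in>UNIV. \<bar>b $ j\<bar>)" using lam_nonneg by (simp add: sum_nonneg)
    ultimately show ?thesis
      by (simp add: elastic_net_objective_def elastic_net_penalty_def n_def[symmetric] diff_divide_distrib)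
  qed
  moreover have "norm v / n \<ge> 0" using n by simp
  ultimately show ?thesis using that by blast
qed

lemma continuous_elastic_net_objective:
  "continuous_on UNIV (elastic_net_objective \<rho> \<mu> lam y X)"
proof -
  have \<rho>: "continuous_on UNIV \<rho>" using deriv DERIV_isCont continuous_at_imp_continuous_on by blast
  have "continuous_on UNIV (\<lambda>b. \<rho> (y $ i - row i X \<bullet> b))" for i
    by (rule continuous_on_compose2[OF \<rho>]) (auto intro!: continuous_intros)
  then have "continuous_on UNIV (\<lambda>b. elastic_net_objective \<rho> \<mu> lam y X b)"
    unfolding elastic_net_objective_def elastic_net_penalty_def by (intro continuous_intros) auto
  then show ?thesis by simp
qed

lemma elastic_net_minimizes:
  "elastic_net_objective \<rho> \<mu> lam y X (elastic_net \<rho> \<mu> lam y X) \<le> elastic_net_objective \<rho> \<mu> lam y X b"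
proof -
  let ?f = "elastic_net_objective \<rho> \<mu> lam y X"
  obtain C K where C: "C \<ge> 0" and lb: "\<And>b. ?f b \<ge> \<mu> * (norm b)\<^sup>2 / 2 - C * norm b - K"
    using elastic_net_objective_lower_bound[of y X] by blast
  define a where "a = \<bar>?f 0 + K\<bar>"
  \<comment> \<open>Beyond this radius \<mu> |z| / 2 - C is at least \<open>a\<close>, and |z| is at
    least 1, so the lower bound at z is at least a - K, hence at least the objective at 0.\<close>
  define R where "R = 2 * (C + a) / \<mu> + 1"
  have R: "R \<ge> 1" using C mu_pos by (simp add: R_def a_def)
  obtain x where x: "x \<in> cball 0 R" "\<And>z. z \<in> cball 0 R \<Longrightarrow> ?f x \<le> ?f z"
    using continuous_attains_inf[of "cball 0 R" ?f] R
      continuous_on_subset[OF continuous_elastic_net_objective[of y X] subset_UNIV, of "cball 0 R"]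
    by (auto simp del: mem_cball)
  have "?f x \<le> ?f z" for z
  proof (cases "norm z \<le> R")
    case True then show ?thesis using x by simp
  next
    case False
    then have z: "norm z > R" by simp
    have "\<mu> * norm z / 2 \<ge> \<mu> * R / 2" using z mu_pos by simp
    also have "\<mu> * R / 2 = C + a + \<mu> / 2" using mu_pos by (simp add: R_def field_simps)
    finally have "\<mu> * norm z / 2 - C \<ge> a" using mu_pos by simp
    then have "(\<mu> * norm z / 2 - C) * norm z \<ge> a * 1"
      using z R by (intro mult_mono) (auto simp: a_def)
    then have "\<mu> * (norm z)\<^sup>2 / 2 - C * norm z \<ge> a" by (simp add: power2_eq_square algebra_simps)
    then have "?f z \<ge> ?f 0" using lb[of z] by (simp add: a_def)
    moreover have "?f x \<le> ?f 0" using x(2)[of 0] R by simp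
    ultimately show ?thesis by simp
  qed
  then have "is_arg_min ?f (\<lambda>_. True) x" by (auto simp: is_arg_min_linorder)
  then have "is_arg_min ?f (\<lambda>_. True) (arg_min ?f (\<lambda>_. True))"
    unfolding arg_min_def by (rule someI)
  then show ?thesis by (auto simp: is_arg_min_linorder elastic_net_def)
qed

lemma elastic_net_soft_threshold:
  fixes y :: "real ^ 'n" and X :: "real ^ 'p ^ 'n"
  defines "\<beta> \<equiv> elastic_net \<rho> \<mu> lam y X"
  shows "real CARD('n) * \<mu> * \<beta> $ j = soft_threshold (real CARD('n) * lam) (score \<psi> X (y - X *v \<beta>) j)"
proof -
  define n where "n = real CARD('n)"
  have n: "n > 0" by (simp add: n_def)
  define r where "r = y - X *v \<beta>"
  have r: "r $ i = y $ i - row i X \<bullet> \<beta>" for i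
    by (simp add: r_def matrix_vector_mult_def row_def inner_vec_def)
  \<comment> \<open>Moving along coordinate j leaves the other absolute values fixed, so
    \<open>q\<close> gathers all terms of the objective that are differentiable in t.\<close>
  define q where "q t = (1 / n) * (\<Sum>i\<in>UNIV. \<rho> (r $ i - t * X $ i $ j)) + \<mu> * (norm (\<beta> + t *\<^sub>R axis j 1))\<^sup>2 / 2
      + lam * (\<Sum>k\<in>UNIV - {j}. \<bar>\<beta> $ k\<bar>)" for t
  have obj: "elastic_net_objective \<rho> \<mu> lam y X (\<beta> + t *\<^sub>R axis j 1) = q t + lam * \<bar>\<beta> $ j + t\<bar>" for t
  proof -
    have "(\<Sum>k\<in>UNIV. \<bar>(\<beta> + t *\<^sub>R axis j 1) $ k\<bar>) = \<bar>\<beta> $ j + t\<bar> + (\<Sum>k\<in>UNIV - {j}. \<bar>\<beta> $ k\<bar>)"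
      by (subst sum.remove[of _ j]) (auto simp: axis_def intro!: sum.cong)
    moreover have "y $ i - row i X \<bullet> (\<beta> + t *\<^sub>R axis j 1) = r $ i - t * X $ i $ j" for i
      by (simp add: r inner_add_right inner_axis row_def)
    ultimately show ?thesis
      unfolding elastic_net_objective_def elastic_net_penalty_def q_def n_def
      by (simp only:) (simp add: distrib_left)
  qed
  have "(q has_real_derivative (1 / n) * (\<Sum>i\<in>UNIV. \<psi> (r $ i) * (- X $ i $ j)) + \<mu> * \<beta> $ j) (at 0)"
  proof -
    have "((\<lambda>t. \<rho> (r $ i - t * X $ i $ j)) has_real_derivative \<psi> (r $ i) * (- X $ i $ j)) (at 0)" for i
      by (rule DERIV_chain2[of \<rho>]) (use deriv in \<open>auto intro!: derivative_eq_intros\<close>)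
    then have 1: "((\<lambda>t. (1 / n) * (\<Sum>i\<in>UNIV. \<rho> (r $ i - t * X $ i $ j))) has_real_derivative
        (1 / n) * (\<Sum>i\<in>UNIV. \<psi> (r $ i) * (- X $ i $ j))) (at 0)"
      by (intro DERIV_cmult DERIV_sum)
    have sq: "(norm (\<beta> + t *\<^sub>R axis j 1))\<^sup>2 = (norm \<beta>)\<^sup>2 + 2 * t * \<beta> $ j + t\<^sup>2" for t
      unfolding power2_norm_eq_inner
      by (simp add: inner_add_left inner_add_right inner_axis inner_commute[of "axis j 1"] inner_axis_axis power2_eq_square distrib_left)
    have "((\<lambda>t. (norm \<beta>)\<^sup>2 + (2 * \<beta> $ j) * t + t\<^sup>2) has_real_derivative
        0 + (2 * \<beta> $ j) * 1 + 2 * 0) (at 0)"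
      using DERIV_pow[of 2 "0::real" UNIV] by (intro DERIV_add DERIV_const DERIV_cmult DERIV_ident) simp
    then have poly: "((\<lambda>t. (norm \<beta>)\<^sup>2 + 2 * t * \<beta> $ j + t\<^sup>2) has_real_derivative 2 * \<beta> $ j) (at 0)"
      by (simp add: mult.commute mult.left_commute)
    have 2: "((\<lambda>t. \<mu> * (norm (\<beta> + t *\<^sub>R axis j 1))\<^sup>2 / 2) has_real_derivative \<mu> * \<beta> $ j) (at 0)"
      using DERIV_cmult[of "\<lambda>t. (norm \<beta>)\<^sup>2 + 2 * t * \<beta> $ j + t\<^sup>2" "2 * \<beta> $ j" 0 UNIV "\<mu> / 2"]
      unfolding sq by (simp add: poly)
    show ?thesis
      unfolding q_def using DERIV_add[OF DERIV_add[OF 1 2] DERIV_const] by simp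
  qed
  moreover have "(1 / n) * (\<Sum>i\<in>UNIV. \<psi> (r $ i) * (- X $ i $ j)) = - score \<psi> X r j / n"
    by (simp add: score_def sum_negf mult.commute)
  moreover have "q 0 + lam * \<bar>\<beta> $ j\<bar> \<le> q t + lam * \<bar>\<beta> $ j + t\<bar>" for t
    using elastic_net_minimizes[of y X "\<beta> + t *\<^sub>R axis j 1"] obj[of t] obj[of 0]
    by (simp add: \<beta>_def)
  ultimately have *: "(\<beta> $ j > 0 \<longrightarrow> - score \<psi> X r j / n + \<mu> * \<beta> $ j + lam = 0) \<and>
      (\<beta> $ j < 0 \<longrightarrow> - score \<psi> X r j / n + \<mu> * \<beta> $ j - lam = 0) \<and>
      \<bar>- score \<psi> X r j / n + \<mu> * \<beta> $ j\<bar> \<le> lam"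
    by (intro abs_penalised_minimum_stationary[of q]) (auto simp: lam_nonneg)
  consider "\<beta> $ j > 0" | "\<beta> $ j < 0" | "\<beta> $ j = 0" by linarith
  then have "n * \<mu> * \<beta> $ j = soft_threshold (n * lam) (score \<psi> X r j)"
  proof cases
    case 1
    then have "score \<psi> X r j = n * \<mu> * \<beta> $ j + n * lam" using * n by (simp add: field_simps)
    moreover have "n * \<mu> * \<beta> $ j > 0" using 1 n mu_pos by simp
    ultimately show ?thesis by (simp add: soft_threshold_def)
  next
    case 2
    then have "score \<psi> X r j = n * \<mu> * \<beta> $ j - n * lam" using * n by (simp add: field_simps)
    moreover have "n * \<mu> * \<beta> $ j < 0" using 2 n mu_pos by (simp add: mult_pos_neg)
    moreover have "n * lam \<ge> 0" using n lam_nonneg by simp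
    ultimately have "score \<psi> X r j < - (n * lam)" "\<not> score \<psi> X r j > n * lam"
      "score \<psi> X r j + n * lam = n * \<mu> * \<beta> $ j" by linarith+
    then show ?thesis by (simp only: soft_threshold_def if_True if_False)
  next
    case 3
    then have "\<bar>score \<psi> X r j\<bar> / n \<le> lam" using * n by (simp add: abs_divide)
    then have "\<bar>score \<psi> X r j\<bar> \<le> n * lam" using n by (simp add: field_simps)
    moreover have "n * lam \<ge> 0" using n lam_nonneg by simp
    ultimately show ?thesis using 3 by (simp add: soft_threshold_eq_0_iff)
  qed
  then show ?thesis by (simp add: n_def r_def)
qed

section \<open>Lipschitz dependence on y\<close>

text \<open>Energy estimate. Firm nonexpansiveness gives n \<mu> |d|^2 \<le> (X d) . u, where X d =
  (y' - y) - (r' - r). As \<psi> is monotone and 1-Lipschitz, (r' - r) . u \<ge> |u|^2, and this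
  absorbs the |u|^2 that arises when (y' - y) . u is split.\<close>

lemma elastic_net_Lipschitz:
  fixes y y' :: "real ^ 'n" and X :: "real ^ 'p ^ 'n"
  shows "sqrt (real CARD('n) * \<mu>) * norm (elastic_net \<rho> \<mu> lam y' X - elastic_net \<rho> \<mu> lam y X) \<le> norm (y' - y)"
proof -
  define n where "n = real CARD('n)"
  have n: "n > 0" by (simp add: n_def)
  define \<beta> \<beta>' where "\<beta> = elastic_net \<rho> \<mu> lam y X" and "\<beta>' = elastic_net \<rho> \<mu> lam y' X"
  define r r' where "r = y - X *v \<beta>" and "r' = y' - X *v \<beta>'"
  define u :: "real ^ 'n" where "u = (\<chi> i. \<psi> (r' $ i) - \<psi> (r $ i))"
  define d where "d = \<beta>' - \<beta>"
  have 1: "n * \<mu> * (d $ j)\<^sup>2 \<le> d $ j * (score \<psi> X r' j - score \<psi> X r j)" for j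
  proof -
    let ?s = "soft_threshold (n * lam) (score \<psi> X r' j) - soft_threshold (n * lam) (score \<psi> X r j)"
    have s: "?s = (n * \<mu>) * d $ j"
      using elastic_net_soft_threshold[of y X j] elastic_net_soft_threshold[of y' X j]
      by (simp add: n_def r_def r'_def \<beta>_def \<beta>'_def d_def algebra_simps)
    have "n * lam \<ge> 0" using n lam_nonneg by simp
    from soft_threshold_firmly_nonexpansive[OF this, of "score \<psi> X r' j" "score \<psi> X r j"]
    have "(n * \<mu>) * (n * \<mu> * (d $ j)\<^sup>2) \<le> (n * \<mu>) * (d $ j * (score \<psi> X r' j - score \<psi> X r j))"
      unfolding s by (simp add: power2_eq_square mult.assoc mult.left_commute)
    then show ?thesis using n mu_pos by (subst (asm) mult_le_cancel_left_pos) auto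
  qed
  have "n * \<mu> * (norm d)\<^sup>2 = (\<Sum>j\<in>UNIV. n * \<mu> * (d $ j)\<^sup>2)"
    by (simp add: norm_vec_def L2_set_def sum_nonneg sum_distrib_left)
  also have "\<dots> \<le> (\<Sum>j\<in>UNIV. d $ j * (score \<psi> X r' j - score \<psi> X r j))"
    by (intro sum_mono 1)
  also have "\<dots> = (\<Sum>j\<in>UNIV. \<Sum>i\<in>UNIV. d $ j * (X $ i $ j * u $ i))"
    by (simp add: score_def u_def sum_subtractf[symmetric] sum_distrib_left algebra_simps)
  also have "\<dots> = (X *v d) \<bullet> u"
    by (subst sum.swap) (simp add: inner_vec_def matrix_vector_mult_def sum_distrib_left sum_distrib_right algebra_simps)
  also have "X *v d = (y' - y) - (r' - r)"
    by (simp add: d_def r_def r'_def matrix_vector_mult_diff_distrib)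
  also have "((y' - y) - (r' - r)) \<bullet> u = (y' - y) \<bullet> u - (r' - r) \<bullet> u"
    by (rule inner_diff_left)
  finally have "n * \<mu> * (norm d)\<^sup>2 \<le> (y' - y) \<bullet> u - (r' - r) \<bullet> u" .
  moreover have "(norm u)\<^sup>2 \<le> (r' - r) \<bullet> u"
  proof -
    have "(\<psi> s - \<psi> t)\<^sup>2 \<le> (s - t) * (\<psi> s - \<psi> t)" for s t
    proof -
      have "\<bar>\<psi> s - \<psi> t\<bar> \<le> \<bar>s - t\<bar>"
        using lipschitz_onD[OF lipschitz, of s t] by (simp add: dist_real_def)
      then have "\<bar>\<psi> s - \<psi> t\<bar> * \<bar>\<psi> s - \<psi> t\<bar> \<le> \<bar>s - t\<bar> * \<bar>\<psi> s - \<psi> t\<bar>"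
        by (intro mult_right_mono) auto
      moreover have "(s - t) * (\<psi> s - \<psi> t) \<ge> 0"
        using monoD[OF mono_psi, of s t] monoD[OF mono_psi, of t s]
        by (cases "s \<le> t") (auto intro: mult_nonpos_nonpos mult_nonneg_nonneg)
      ultimately show ?thesis by (simp add: power2_eq_square flip: abs_mult)
    qed
    then have "(\<Sum>i\<in>UNIV. (u $ i)\<^sup>2) \<le> (\<Sum>i\<in>UNIV. (r' - r) $ i * u $ i)"
      by (intro sum_mono) (simp add: u_def)
    then show ?thesis
      by (simp add: norm_vec_def L2_set_def sum_nonneg inner_vec_def)
  qed
  moreover have "(y' - y) \<bullet> u \<le> norm (y' - y) * norm u" by (rule norm_cauchy_schwarz)
  moreover have "2 * (norm (y' - y) * norm u) \<le> (norm (y' - y))\<^sup>2 + (norm u)\<^sup>2"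
    using sum_squares_bound[of "norm (y' - y)" "norm u"] by simp
  moreover have "0 \<le> (norm u)\<^sup>2" "0 \<le> (norm (y' - y))\<^sup>2" by simp_all
  ultimately have "n * \<mu> * (norm d)\<^sup>2 \<le> (norm (y' - y))\<^sup>2" by linarith
  then have "(sqrt (n * \<mu>) * norm d)\<^sup>2 \<le> (norm (y' - y))\<^sup>2"
    using n mu_pos by (simp add: power_mult_distrib)
  then show ?thesis
    unfolding n_def d_def \<beta>_def \<beta>'_def by (rule power2_le_imp_le) simp
qed

section \<open>Linearisation at regular points, and the two derivatives\<close>

lemma deriv_psi_nonneg:
  assumes "\<psi> differentiable at t"
  shows "deriv \<psi> t \<ge> 0"
proof (rule ccontr)
  assume "\<not> deriv \<psi> t \<ge> 0"
  moreover have "(\<psi> has_real_derivative deriv \<psi> t) (at t)"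
    using assms by (simp add: DERIV_deriv_iff_real_differentiable)
  ultimately obtain \<delta> where "\<delta> > 0" "\<And>h. 0 < h \<Longrightarrow> h < \<delta> \<Longrightarrow> \<psi> (t + h) < \<psi> t"
    using DERIV_neg_dec_right[of \<psi> "deriv \<psi> t" t] by auto
  then have "\<psi> (t + \<delta> / 2) < \<psi> t" by simp
  moreover have "\<psi> t \<le> \<psi> (t + \<delta> / 2)" using \<open>\<delta> > 0\<close> by (intro monoD[OF mono_psi]) simp
  ultimately show False by simp
qed

definition residual :: "real ^ 'p ^ 'n \<Rightarrow> real ^ 'n \<Rightarrow> real ^ 'n" where
  "residual X y = y - X *v elastic_net \<rho> \<mu> lam y X"

lemma residual_Lipschitz:
  fixes X :: "real ^ 'p ^ 'n"
  obtains L where "\<And>y y'. norm (residual X y' - residual X y) \<le> L * norm (y' - y)"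
proof -
  obtain K where K: "K > 0" "\<And>v. norm (X *v v) \<le> norm v * K"
    using bounded_linear.pos_bounded[OF matrix_vector_mul_bounded_linear[of X]] by blast
  define s where "s = sqrt (real CARD('n) * \<mu>)"
  have s: "s > 0" using mu_pos by (simp add: s_def)
  have "norm (residual X y' - residual X y) \<le> (1 + K / s) * norm (y' - y)" for y y'
  proof -
    define d where "d = elastic_net \<rho> \<mu> lam y' X - elastic_net \<rho> \<mu> lam y X"
    have "s * norm d \<le> norm (y' - y)"
      unfolding s_def d_def by (rule elastic_net_Lipschitz)
    then have "norm d \<le> norm (y' - y) / s" using s by (simp add: field_simps)
    then have "norm d * K \<le> norm (y' - y) / s * K" using K(1) by (intro mult_right_mono) auto
    then have "norm (X *v d) \<le> norm (y' - y) / s * K" using K(2)[of d] by linarith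
    moreover have "residual X y' - residual X y = (y' - y) - X *v d"
      by (simp add: residual_def d_def matrix_vector_mult_diff_distrib)
    then have "norm (residual X y' - residual X y) \<le> norm (y' - y) + norm (X *v d)"
      by (simp only: norm_triangle_ineq4)
    ultimately have "norm (residual X y' - residual X y) \<le> norm (y' - y) + norm (y' - y) / s * K"
      by linarith
    then show ?thesis by (simp add: distrib_right mult.commute[of _ K])
  qed
  then show ?thesis using that by blast
qed

text \<open>Where a score sits exactly at the threshold the soft threshold has a kink, which is harmless if
  \<open>\<psi>\<close> is flat at every residual: then the score is constant to first order.\<close>

lemma elastic_net_linearisation:
  fixes X :: "real ^ 'p ^ 'n"
  defines "\<beta> \<equiv> \<lambda>y. elastic_net \<rho> \<mu> lam y X"
  assumes diff: "\<And>i. \<psi> differentiable at (residual X y $ i)"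
    and kink: "\<And>j. \<bar>score \<psi> X (residual X y) j\<bar> \<noteq> real CARD('n) * lam
      \<or> (\<forall>i. deriv \<psi> (residual X y $ i) = 0)"
  shows "((\<lambda>y'. real CARD('n) * \<mu> * \<beta> y' $ j - (if j \<in> active_set (\<beta> y) then
      \<Sum>i\<in>UNIV. X $ i $ j * (deriv \<psi> (residual X y $ i) * residual X y' $ i) else 0))
    has_derivative (\<lambda>h. 0)) (at y)"
proof -
  let ?c = "real CARD('n) * lam"
  define r where "r = residual X"
  define d where "d i = deriv \<psi> (r y $ i)" for i
  define f where "f y' = score \<psi> X (r y') j" for y'
  \<comment> \<open>The first-order part of the score, written with the residual itself and not with
    its derivative, whose existence is still open here.\<close>
  define m where "m y' = (\<Sum>i\<in>UNIV. X $ i $ j * (d i * r y' $ i))" for y'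
  have c: "?c \<ge> 0" using lam_nonneg by simp
  obtain L where L: "\<And>y'. norm (r y' - r y) \<le> L * norm (y' - y)"
    using residual_Lipschitz[of X] unfolding r_def by metis
  have rL: "\<bar>r y' $ i - r y $ i\<bar> \<le> L * norm (y' - y)" for y' i
    using component_le_norm_cart[of "r y' - r y" i] L[of y'] by simp
  have "(\<psi> has_real_derivative d i) (at (r y $ i))" for i
    using diff[of i] by (simp add: d_def r_def DERIV_deriv_iff_real_differentiable)
  then have "((\<lambda>y'. \<psi> (r y' $ i) - d i * r y' $ i) has_derivative (\<lambda>h. 0)) (at y)" for i
    by (rule has_derivative_compose_Lipschitz_remainder) (rule rL)
  then have "((\<lambda>y'. \<Sum>i\<in>UNIV. X $ i $ j * (\<psi> (r y' $ i) - d i * r y' $ i)) has_derivative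
      (\<lambda>h. \<Sum>i\<in>UNIV. X $ i $ j * 0)) (at y)"
    by (intro has_derivative_sum has_derivative_mult_right)
  then have fm: "((\<lambda>y'. f y' - m y') has_derivative (\<lambda>h. 0)) (at y)"
    by (simp add: f_def m_def score_def right_diff_distrib sum_subtractf)
  have st: "real CARD('n) * \<mu> * \<beta> y' $ j = soft_threshold ?c (f y')" for y'
    unfolding \<beta>_def f_def r_def residual_def by (rule elastic_net_soft_threshold)
  have fL: "\<bar>f y' - f y\<bar> \<le> ((\<Sum>i\<in>UNIV. \<bar>X $ i $ j\<bar>) * L) * norm (y' - y)" for y'
  proof -
    have "\<bar>f y' - f y\<bar> = \<bar>\<Sum>i\<in>UNIV. X $ i $ j * (\<psi> (r y' $ i) - \<psi> (r y $ i))\<bar>"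
      by (simp add: f_def score_def right_diff_distrib sum_subtractf)
    also have "\<dots> \<le> (\<Sum>i\<in>UNIV. \<bar>X $ i $ j\<bar> * (L * norm (y' - y)))"
    proof (rule order_trans[OF sum_abs], rule sum_mono)
      fix i
      have "\<bar>\<psi> (r y' $ i) - \<psi> (r y $ i)\<bar> \<le> \<bar>r y' $ i - r y $ i\<bar>"
        using lipschitz_onD[OF lipschitz, of "r y' $ i" "r y $ i"] by (simp add: dist_real_def)
      then show "\<bar>X $ i $ j * (\<psi> (r y' $ i) - \<psi> (r y $ i))\<bar> \<le> \<bar>X $ i $ j\<bar> * (L * norm (y' - y))"
        unfolding abs_mult using rL[of y' i] by (intro mult_left_mono) auto
    qed
    finally show ?thesis by (simp add: sum_distrib_right mult.assoc)
  qed
  have active: "j \<in> active_set (\<beta> y) \<longleftrightarrow> soft_threshold ?c (f y) \<noteq> 0"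
    using st[of y] mu_pos by (auto simp: active_set_def)
  have "((\<lambda>y'. soft_threshold ?c (f y') - (if j \<in> active_set (\<beta> y) then m y' else 0))
      has_derivative (\<lambda>h. 0)) (at y)"
  proof (cases "\<bar>f y\<bar> = ?c")
    case True
    then have "d i = 0" for i using kink[of j] by (simp add: f_def d_def r_def)
    then have m0: "m y' = 0" for y' by (simp add: m_def)
    have "((\<lambda>y'. soft_threshold ?c (f y')) has_derivative (\<lambda>h. 0)) (at y)"
    proof (rule has_derivative_zero_dominated)
      show "(f has_derivative (\<lambda>h. 0)) (at y)" using fm by (simp add: m0)
    qed (rule soft_threshold_nonexpansive[OF c])
    then show ?thesis by (cases "j \<in> active_set (\<beta> y)") (simp_all add: m0)
  next
    case False
    \<comment> \<open>The slope of the soft threshold at \<open>f y\<close>: 1 for an active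
      coordinate, 0 for an inactive one.\<close>
    define e where "e = (if soft_threshold ?c (f y) = 0 then 0 else 1 :: real)"
    have "((\<lambda>y'. soft_threshold ?c (f y') - e * f y') has_derivative (\<lambda>h. 0)) (at y)"
      by (rule has_derivative_compose_Lipschitz_remainder[OF _ fL])
        (use soft_threshold_has_derivative[OF c False] in \<open>simp add: e_def\<close>)
    from has_derivative_add[OF this has_derivative_mult_right[OF fm, of e]]
    have "((\<lambda>y'. soft_threshold ?c (f y') - e * m y') has_derivative (\<lambda>h. 0)) (at y)"
      by (simp add: algebra_simps)
    then show ?thesis using active by (cases "j \<in> active_set (\<beta> y)") (simp_all add: e_def)
  qed
  then show ?thesis unfolding st m_def d_def r_def .
qed

text \<open>Substituting \<open>y' - X *v \<beta> y'\<close> for the residual turns the linearised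
  condition into: \<open>M *v \<beta> y' - T *v (D *v y')\<close> has derivative 0 at y, with M, T
  and D frozen at y. Applying the inverse of M isolates \<beta>, so its differentiability
  follows.\<close>

lemma elastic_net_has_derivative:
  fixes X :: "real ^ 'p ^ 'n"
  defines "\<beta> \<equiv> \<lambda>y. elastic_net \<rho> \<mu> lam y X"
  assumes diff: "\<And>i. \<psi> differentiable at (residual X y $ i)"
    and kink: "\<And>j. \<bar>score \<psi> X (residual X y) j\<bar> \<noteq> real CARD('n) * lam
      \<or> (\<forall>i. deriv \<psi> (residual X y $ i) = 0)"
  defines "D \<equiv> diag_matrix (\<chi> i. deriv \<psi> (residual X y $ i))"
  shows "((\<lambda>y'. X *v \<beta> y') has_derivative (\<lambda>h. (active_resolvent \<mu> X (active_set (\<beta> y)) D ** D) *v h)) (at y)"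
proof -
  define S where "S = active_set (\<beta> y)"
  define M where "M = active_gram \<mu> X S D"
  define T where "T = masked_transpose X S"
  have nonneg: "(\<chi> i. deriv \<psi> (residual X y $ i)) $ i \<ge> 0" for i
    using deriv_psi_nonneg[OF diff] by simp
  have "invertible M"
    unfolding M_def D_def by (rule active_gram_invertible[OF mu_pos nonneg])
  then have BM: "matrix_inv M ** M = mat 1"
    by (rule invertible_matrix_inv)
  have "((\<lambda>y'. M *v \<beta> y' - T *v (D *v y')) has_derivative (\<lambda>h. 0)) (at y)"
  proof (rule has_derivative_componentI)
    fix j
    have "(M *v \<beta> y' - T *v (D *v y')) $ j = real CARD('n) * \<mu> * \<beta> y' $ j - (if j \<in> S then
      \<Sum>i\<in>UNIV. X $ i $ j * (deriv \<psi> (residual X y $ i) * residual X y' $ i) else 0)" for y'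
    proof -
      have "X *v \<beta> y' = y' - residual X y'" by (simp add: residual_def \<beta>_def)
      then have "M *v \<beta> y' - T *v (D *v y') = (real CARD('n) * \<mu>) *\<^sub>R \<beta> y' - T *v (D *v residual X y')"
        by (simp add: M_def T_def active_gram_vector_mult matrix_vector_mult_diff_distrib)
      then show ?thesis
        by (simp add: T_def D_def masked_transpose_vector_mult diag_matrix_vector_mult)
    qed
    then show "((\<lambda>y'. (M *v \<beta> y' - T *v (D *v y')) $ j) has_derivative (\<lambda>h. 0 $ j)) (at y)"
      using elastic_net_linearisation[OF diff kink, of j] by (simp add: S_def \<beta>_def)
  qed
  moreover have "((\<lambda>y'. T *v (D *v y')) has_derivative (\<lambda>h. T *v (D *v h))) (at y)"
    by (intro bounded_linear.has_derivative[OF matrix_vector_mul_bounded_linear] has_derivative_ident)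
  ultimately have "((\<lambda>y'. M *v \<beta> y' - T *v (D *v y') + T *v (D *v y')) has_derivative
      (\<lambda>h. 0 + T *v (D *v h))) (at y)"
    by (rule has_derivative_add)
  then have "((\<lambda>y'. X *v (matrix_inv M *v (M *v \<beta> y'))) has_derivative
      (\<lambda>h. X *v (matrix_inv M *v (T *v (D *v h))))) (at y)"
    by (intro bounded_linear.has_derivative[OF matrix_vector_mul_bounded_linear]) simp
  moreover have "X *v (matrix_inv M *v (M *v b)) = X *v b" for b
    by (simp add: matrix_vector_mul_assoc BM)
  moreover have "active_resolvent \<mu> X S D = X ** matrix_inv M ** T"
    unfolding D_def M_def T_def by (rule active_resolvent_eq[OF mu_pos nonneg])
  ultimately show ?thesis
    by (simp add: S_def matrix_vector_mul_assoc matrix_mul_assoc)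
qed

text \<open>The chain rule yields D (I - R D); the symmetric form is the same matrix, because D' D'
  = D.\<close>

lemma psi_residual_has_derivative:
  fixes X :: "real ^ 'p ^ 'n"
  assumes diff: "\<And>i. \<psi> differentiable at (residual X y $ i)"
    and deriv: "((\<lambda>y'. X *v elastic_net \<rho> \<mu> lam y' X) has_derivative (\<lambda>h. (R ** D) *v h)) (at y)"
  defines "D' \<equiv> diag_matrix (\<chi> i. sqrt (deriv \<psi> (residual X y $ i)))"
  assumes D: "D = diag_matrix (\<chi> i. deriv \<psi> (residual X y $ i))"
  shows "((\<lambda>y'. \<chi> i. \<psi> (residual X y' $ i)) has_derivative
    (\<lambda>h. (D' ** (mat 1 - D' ** R ** D') ** D') *v h)) (at y)"
proof (rule has_derivative_componentI)
  fix i
  have D'D': "D' *v (D' *v v) = D *v v" for v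
    using deriv_psi_nonneg[OF diff]
    by (simp add: D'_def D matrix_vector_mul_assoc diag_matrix_mult)
  have "(D' ** (mat 1 - D' ** R ** D') ** D') *v h = D *v (h - (R ** D) *v h)" for h
    by (simp add: matrix_vector_mul_assoc[symmetric] matrix_vector_mult_diff_rdistrib
        matrix_vector_mult_diff_distrib D'D')
  then have eq: "((D' ** (mat 1 - D' ** R ** D') ** D') *v h) $ i
      = (h - (R ** D) *v h) $ i * deriv \<psi> (residual X y $ i)" for h
    by (simp add: D diag_matrix_vector_mult mult.commute)
  have "(residual X has_derivative (\<lambda>h. h - (R ** D) *v h)) (at y)"
    unfolding residual_def[abs_def] by (intro has_derivative_diff has_derivative_ident deriv)
  then have "((\<lambda>y'. residual X y' $ i) has_derivative (\<lambda>h. (h - (R ** D) *v h) $ i)) (at y)"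
    by (rule bounded_linear.has_derivative[OF bounded_linear_vec_nth])
  moreover have "(\<psi> has_real_derivative deriv \<psi> (residual X y $ i)) (at (residual X y $ i))"
    using diff[of i] by (simp add: DERIV_deriv_iff_real_differentiable)
  ultimately have "((\<lambda>y'. \<psi> (residual X y' $ i)) has_derivative
      (\<lambda>h. (h - (R ** D) *v h) $ i * deriv \<psi> (residual X y $ i))) (at y)"
    by (intro DERIV_compose_FDERIV)
  then show "((\<lambda>y'. (\<chi> i. \<psi> (residual X y' $ i)) $ i) has_derivative
      (\<lambda>h. ((D' ** (mat 1 - D' ** R ** D') ** D') *v h) $ i)) (at y)"
    by (simp add: eq)
qed

section \<open>The exceptional set is null\<close>

lemma negligible_irregular_points:
  "negligible {t. \<not> \<psi> differentiable at t \<or> (\<psi> t = 0 \<and> deriv \<psi> t \<noteq> 0)}"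
proof -
  \<comment> \<open>A monotone function vanishes between two of its zeros, so at most one zero has nonzero derivative.\<close>
  define A where "A = {t. \<psi> differentiable at t \<and> \<psi> t = 0 \<and> deriv \<psi> t \<noteq> 0}"
  have flat: "deriv \<psi> x = 0" if x: "\<psi> differentiable at x" "x \<in> {s..t}" and st: "s < t" "\<psi> s = 0" "\<psi> t = 0" for s t x
  \<comment> \<open>The point x may be an endpoint, where \<psi> is known to vanish on one side
    only; derivatives within the closed interval are still unique there.\<close>
  proof (rule vector_derivative_unique_within_closed_interval)
    show "s < t" "x \<in> cbox s t" using x st by auto
    show "(\<psi> has_vector_derivative deriv \<psi> x) (at x within cbox s t)"
      using x(1) by (auto simp: DERIV_deriv_iff_real_differentiable has_real_derivative_iff_has_vector_derivative[symmetric]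
          intro: has_field_derivative_at_within)
    have "\<psi> u = 0" if "u \<in> {s..t}" for u
      using that st monoD[OF mono_psi, of s u] monoD[OF mono_psi, of u t] by simp
    then show "(\<psi> has_vector_derivative 0) (at x within cbox s t)"
      using x(2) by (intro has_vector_derivative_transform[OF _ _ has_vector_derivative_const[of 0]]) auto
  qed
  have "s = t" if "s \<in> A" "t \<in> A" for s t
    using that flat[of s s t] flat[of s t s] unfolding A_def by (cases s t rule: linorder_cases) auto
  then have "A = {} \<or> (\<exists>a. A = {a})" by blast
  then have "finite A" by auto
  then have "negligible ({t. \<not> \<psi> differentiable at t} \<union> A)"
    using mono_Lipschitz_differentiable_ae[OF mono_psi lipschitz]
    by (intro negligible_Un) (auto intro: negligible_finite)
  then show ?thesis by (rule negligible_subset) (auto simp: A_def)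
qed

text \<open>Recovers (y, X) from (residual, X), so that bad data become an image of bad residuals.
  Carrying X along keeps the dimensions of domain and range equal, as the theorem on images of null
  sets requires.\<close>

definition response :: "(real ^ 'n) \<times> (real ^ 'p ^ 'n) \<Rightarrow> (real ^ 'n) \<times> (real ^ 'p ^ 'n)" where
  "response = (\<lambda>(r, X). (r + X *v (\<chi> j. soft_threshold (real CARD('n) * lam) (score \<psi> X r j)
     / (real CARD('n) * \<mu>)), X))"

lemma response_residual:
  fixes X :: "real ^ 'p ^ 'n"
  shows "response (y - X *v elastic_net \<rho> \<mu> lam y X, X) = (y, X)"
proof -
  have n: "real CARD('n) * \<mu> \<noteq> 0" using mu_pos by simp
  have "(\<chi> j. soft_threshold (real CARD('n) * lam) (score \<psi> X (y - X *v elastic_net \<rho> \<mu> lam y X) j)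
     / (real CARD('n) * \<mu>)) = elastic_net \<rho> \<mu> lam y X"
    unfolding elastic_net_soft_threshold[symmetric] using n by (simp add: vec_eq_iff)
  then show ?thesis by (simp add: response_def)
qed

lemma pointwise_lipschitz_response:
  "pointwise_lipschitz (response :: (real ^ 'n) \<times> (real ^ 'p ^ 'n) \<Rightarrow> _) z"
proof -
  let ?c = "real CARD('n) * lam" and ?m = "real CARD('n) * \<mu>"
  have "1-lipschitz_on UNIV (soft_threshold ?c)"
    using lam_nonneg by (intro lipschitz_onI) (auto simp: dist_real_def soft_threshold_nonexpansive)
  note lips = pointwise_lipschitz_compose_lipschitz[OF this] pointwise_lipschitz_compose_lipschitz[OF lipschitz]
  have r: "pointwise_lipschitz (\<lambda>z :: (real ^ 'n) \<times> (real ^ 'p ^ 'n). fst z $ i) z" for i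
    by (intro pointwise_lipschitz_bounded_linear bounded_linear_compose[OF bounded_linear_vec_nth] bounded_linear_fst)
  have X: "pointwise_lipschitz (\<lambda>z :: (real ^ 'n) \<times> (real ^ 'p ^ 'n). snd z $ i $ j) z" for i j
    by (intro pointwise_lipschitz_bounded_linear bounded_linear_compose[OF bounded_linear_vec_nth] bounded_linear_snd)
  have "pointwise_lipschitz (\<lambda>z :: (real ^ 'n) \<times> (real ^ 'p ^ 'n).
      soft_threshold ?c (score \<psi> (snd z) (fst z) j) / ?m) z" for j
  proof -
    have "pointwise_lipschitz (\<lambda>z :: (real ^ 'n) \<times> (real ^ 'p ^ 'n). soft_threshold ?c (score \<psi> (snd z) (fst z) j)) z"
      unfolding score_def
      by (intro lips(1) pointwise_lipschitz_sum pointwise_lipschitz_bilinear[OF bounded_bilinear_mult] X lips(2) r)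
    moreover have "pointwise_lipschitz (\<lambda>z :: (real ^ 'n) \<times> (real ^ 'p ^ 'n). 1 / ?m) z"
      by (rule pointwise_lipschitz_const)
    ultimately have "pointwise_lipschitz (\<lambda>z :: (real ^ 'n) \<times> (real ^ 'p ^ 'n).
      soft_threshold ?c (score \<psi> (snd z) (fst z) j) * (1 / ?m)) z"
      by (rule pointwise_lipschitz_bilinear[OF bounded_bilinear_mult])
    then show ?thesis by simp
  qed
  then have "pointwise_lipschitz (\<lambda>z :: (real ^ 'n) \<times> (real ^ 'p ^ 'n). (\<chi> i. fst z $ i +
      (\<Sum>j\<in>UNIV. snd z $ i $ j * (soft_threshold ?c (score \<psi> (snd z) (fst z) j) / ?m)), snd z)) z"
    by (intro pointwise_lipschitz_Pair pointwise_lipschitz_vec pointwise_lipschitz_add r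
        pointwise_lipschitz_sum pointwise_lipschitz_bilinear[OF bounded_bilinear_mult] X
        pointwise_lipschitz_bounded_linear[OF bounded_linear_snd])
  moreover have "response = (\<lambda>z :: (real ^ 'n) \<times> (real ^ 'p ^ 'n). (\<chi> i. fst z $ i +
      (\<Sum>j\<in>UNIV. snd z $ i $ j * (soft_threshold ?c (score \<psi> (snd z) (fst z) j) / ?m)), snd z))"
    by (auto simp: response_def fun_eq_iff vec_eq_iff matrix_vector_mult_def)
  ultimately show ?thesis by simp
qed

lemma AE_regular_residual:
  "AE (y, X) in (lborel :: ((real ^ 'n) \<times> (real ^ 'p ^ 'n)) measure).
    (\<forall>i. \<psi> differentiable at (residual X y $ i)) \<and>
    (\<forall>j. \<bar>score \<psi> X (residual X y) j\<bar> \<noteq> real CARD('n) * lam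
      \<or> (\<forall>i. deriv \<psi> (residual X y $ i) = 0))"
proof -
  let ?c = "real CARD('n) * lam"
  let ?P = "\<lambda>(r :: real ^ 'n) (X :: real ^ 'p ^ 'n).
    (\<forall>i. \<psi> differentiable at (r $ i)) \<and>
    (\<forall>j. \<bar>score \<psi> X r j\<bar> \<noteq> ?c \<or> (\<forall>i. deriv \<psi> (r $ i) = 0))"
  define N where "N = {t. \<not> \<psi> differentiable at t \<or> (\<psi> t = 0 \<and> deriv \<psi> t \<noteq> 0)}"
  define U :: "'n \<Rightarrow> ((real ^ 'n) \<times> (real ^ 'p ^ 'n)) set" where "U i = {z. fst z $ i \<in> N}" for i
  define V :: "real \<Rightarrow> 'p \<Rightarrow> ((real ^ 'n) \<times> (real ^ 'p ^ 'n)) set"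
    where "V c j = {(r, X). score \<psi> X r j = c \<and> (\<exists>i. \<psi> (r $ i) \<noteq> 0)}" for c j
  define Z where "Z = (\<Union>i. U i) \<union> (\<Union>j. V ?c j \<union> V (- ?c) j)"
  have cont: "continuous_on UNIV \<psi>" using lipschitz by (rule lipschitz_on_continuous_on)
  have "negligible (U i)" for i
  proof -
    have "negligible {z :: (real ^ 'n) \<times> (real ^ 'p ^ 'n). z \<bullet> (axis i 1, 0) \<in> N}"
      unfolding N_def by (intro negligible_vimage_inner negligible_irregular_points) (simp add: zero_prod_def)
    then show ?thesis by (simp add: U_def inner_prod_def inner_axis)
  qed
  moreover have "negligible (V c j)" for c j
    unfolding V_def score_def by (rule negligible_weighted_column_level[OF cont])
  ultimately have "negligible Z"
    unfolding Z_def by (intro negligible_Un negligible_Union) auto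
  then have "negligible (response ` Z)"
    by (rule negligible_pointwise_lipschitz_image[rotated]) (auto intro: pointwise_lipschitz_response)
  moreover have "{z. \<not> (case z of (y, X) \<Rightarrow> ?P (residual X y) X)} \<subseteq> response ` Z"
  proof clarify
    fix y :: "real ^ 'n" and X :: "real ^ 'p ^ 'n"
    let ?r = "residual X y"
    assume "\<not> ?P ?r X"
    then have "(?r, X) \<in> Z"
    proof (rule contrapos_np)
      assume "(?r, X) \<notin> Z"
      then have N: "?r $ i \<notin> N" and V: "score \<psi> X ?r j \<notin> {?c, - ?c} \<or> \<psi> (?r $ i) = 0" for i j
        unfolding Z_def U_def V_def by auto
      have "\<psi> differentiable at (?r $ i)" for i using N[of i] by (simp add: N_def)
      \<comment> \<open>The alternative may be proved for each i separately, as its first half does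
        not depend on i. If \<psi> vanishes at this residual, avoiding \<open>N\<close> makes the
        derivative 0; otherwise this i witnesses \<psi>(r) \<noteq> 0 and avoiding \<open>V\<close>
        keeps the score off both thresholds.\<close>
      moreover have "\<bar>score \<psi> X ?r j\<bar> \<noteq> ?c \<or> deriv \<psi> (?r $ i) = 0" for i j
      proof (cases "\<psi> (?r $ i) = 0")
        case True
        then show ?thesis using N[of i] by (simp add: N_def)
      next
        case False
        then show ?thesis using V[of j i] by auto
      qed
      ultimately show "?P ?r X" by blast
    qed
    moreover have "(y, X) = response (?r, X)"
      unfolding residual_def by (rule response_residual[symmetric])
    ultimately show "(y, X) \<in> response ` Z" by (rule image_eqI[rotated])
  qed
  ultimately show ?thesis
    unfolding AE_lborel_iff_negligible by (rule negligible_subset)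
qed

end

theorem proposition2p3:
  fixes \<rho> \<psi> :: "real \<Rightarrow> real" and \<mu> lam :: real
  assumes "convex_on UNIV \<rho>"
    and "\<And>t. (\<rho> has_real_derivative \<psi> t) (at t)"
    and "1-lipschitz_on UNIV \<psi>"
    and "\<mu> > 0" and "lam \<ge> 0"
  shows "AE (y, X) in (lborel :: ((real ^ 'n) \<times> (real ^ 'p ^ 'n)) measure).
    let \<beta> = elastic_net \<rho> \<mu> lam y X;
        r = y - X *v \<beta>;
        D = diag_matrix (\<chi> i. deriv \<psi> (r $ i));
        Dh = diag_matrix (\<chi> i. sqrt (deriv \<psi> (r $ i)));
        R = active_resolvent \<mu> X (active_set \<beta>) D
    in (\<forall>i. \<psi> differentiable at (r $ i)) \<and>
       ((\<lambda>y'. X *v elastic_net \<rho> \<mu> lam y' X) has_derivative (\<lambda>h. (R ** D) *v h)) (at y) \<and>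
       ((\<lambda>y'. \<chi> i. \<psi> ((y' - X *v elastic_net \<rho> \<mu> lam y' X) $ i)) has_derivative
          (\<lambda>h. (Dh ** (mat 1 - Dh ** R ** Dh) ** Dh) *v h)) (at y)"
proof -
  interpret elastic_net_problem \<rho> \<psi> \<mu> lam by unfold_locales fact+
  have regular: "(\<forall>i. \<psi> differentiable at (residual X y $ i)) \<and>
      ((\<lambda>y'. X *v elastic_net \<rho> \<mu> lam y' X) has_derivative (\<lambda>h. (R ** D) *v h)) (at y) \<and>
      ((\<lambda>y'. \<chi> i. \<psi> (residual X y' $ i)) has_derivative
          (\<lambda>h. (Dh ** (mat 1 - Dh ** R ** Dh) ** Dh) *v h)) (at y)"
    if reg: "(\<forall>i. \<psi> differentiable at (residual X y $ i)) \<and>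
      (\<forall>j. \<bar>score \<psi> X (residual X y) j\<bar> \<noteq> real CARD('n) * lam
        \<or> (\<forall>i. deriv \<psi> (residual X y $ i) = 0))"
      and D: "D = diag_matrix (\<chi> i. deriv \<psi> (residual X y $ i))"
      and Dh: "Dh = diag_matrix (\<chi> i. sqrt (deriv \<psi> (residual X y $ i)))"
      and R: "R = active_resolvent \<mu> X (active_set (elastic_net \<rho> \<mu> lam y X)) D"
    for y :: "real ^ 'n" and X :: "real ^ 'p ^ 'n" and D Dh R
  proof -
    have diff: "\<psi> differentiable at (residual X y $ i)" for i using reg by blast
    have "((\<lambda>y'. X *v elastic_net \<rho> \<mu> lam y' X) has_derivative (\<lambda>h. (R ** D) *v h)) (at y)"
      unfolding R D by (rule elastic_net_has_derivative) (use reg in blast)+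
    from this psi_residual_has_derivative[OF diff this D] show ?thesis
      using diff unfolding Dh by blast
  qed
  show ?thesis
    using AE_regular_residual
  proof eventually_elim
    case (elim z)
    obtain y X where z: "z = (y, X)" by (cases z)
    show ?case
      using regular[OF _ refl refl refl, of X y] elim
      unfolding z Let_def residual_def by simp
  qed
qed

end
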